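(* Let $\ell$ be a nonnegative integer, let $\lambda$ be an integer partition with $\lambda_1\le\ell$, let $q$ be a complex number with $|q|<1$, and let $z$ be a complex number. Then $$\sum_{\mu:\ \mu_1\le\ell}\frac{z^{|\mu|}q^{2n(\mu)+|\mu|-(\lambda'|\mu')}}{b_\mu(q)}\,(zq^{\mu'_\ell+1};q)_\infty=\sum_{\nu\subseteq\lambda}C_{\lambda,\nu}(1/q)\,z^{|\nu|},$$ where the left sum is over all partitions $\mu$ with $\mu_1\le\ell$.
   Context: For a partition $\mu$: $\mu'$ is its conjugate ($\mu'_i=\#\{j:\mu_j\ge i\}$), $|\mu|=\sum\mu_i$, $n(\mu)=\sum_{i\ge1}(i-1)\mu_i=\sum_{i\ge1}\binom{\mu'_i}{2}$, and $b_\mu(q)=\prod_{i\ge1}(q;q)_{\mu'_i-\mu'_{i+1}}$. $(\lambda'|\mu')=\sum_{i\ge1}\lambda'_i\mu'_i$. $(a;q)_k=(1-a)\cdots(1-aq^{k-1})$, $(a;q)_\infty=\prod_{j\ge0}(1-aq^j)$, $(q)_k=(q;q)_k$, $\begin{bmatrix}n\\k\end{bmatrix}_q=\frac{(q)_n}{(q)_k(q)_{n-k}}$. $\nu\subseteq\lambda$ means $\nu_i\le\lambda_i$ for all $i$, and $C_{\lambda,\nu}(q)=q^{\sum_{i\ge1}\nu'_{i+1}(\lambda'_i-\nu'_i)}\prod_{i\ge1}\begin{bmatrix}\lambda'_i-\nu'_{i+1}\\ \lambda'_i-\nu'_i\end{bmatrix}_q$. *)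

theory Defs
  imports "HOL-Analysis.Analysis"
begin

text \<open>A partition is the weakly decreasing list of its nonzero parts, so that distinct lists are
  distinct partitions. Parts are numbered from 1 and padded with zeros.\<close>

definition is_partition :: "nat list \<Rightarrow> bool" where
  "is_partition p \<longleftrightarrow> sorted_wrt (\<ge>) p \<and> (\<forall>x\<in>set p. 0 < x)"

definition part :: "nat list \<Rightarrow> nat \<Rightarrow> nat" where
  "part p i = (if 1 \<le> i \<and> i \<le> length p then p ! (i - 1) else 0)"

definition psize :: "nat list \<Rightarrow> nat" where
  "psize p = (\<Sum>i=1..length p. part p i)"

text \<open>For \<open>i = 0\<close> the set below is infinite, the true value is infinity, and \<open>card\<close> returns a
  dummy 0; the definitions that follow only use \<open>i \<ge> 1\<close>.\<close>

definition conj_part :: "nat list \<Rightarrow> nat \<Rightarrow> nat" where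
  "conj_part p i = card {j. 1 \<le> j \<and> i \<le> part p j}"

definition n_part :: "nat list \<Rightarrow> nat" where
  "n_part p = (\<Sum>i=1..length p. (i - 1) * part p i)"

text \<open>In the sums and products over \<open>i \<ge> 1\<close> below, the range stops at the largest part: beyond it
  the conjugate parts vanish, so the summands are 0 and the factors are 1.\<close>

definition conj_inner :: "nat list \<Rightarrow> nat list \<Rightarrow> nat" where
  "conj_inner la mu = (\<Sum>i=1..part la 1. conj_part la i * conj_part mu i)"

definition contained :: "nat list \<Rightarrow> nat list \<Rightarrow> bool" where
  "contained nu la \<longleftrightarrow> (\<forall>i\<ge>1. part nu i \<le> part la i)"

definition qpoch :: "complex \<Rightarrow> complex \<Rightarrow> nat \<Rightarrow> complex" where
  "qpoch a q k = (\<Prod>j<k. 1 - a * q ^ j)"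

definition qpoch_inf :: "complex \<Rightarrow> complex \<Rightarrow> complex" where
  "qpoch_inf a q = (\<Prod>j. 1 - a * q ^ j)"

definition qbinomial :: "nat \<Rightarrow> nat \<Rightarrow> complex \<Rightarrow> complex" where
  "qbinomial n k q = qpoch q q n / (qpoch q q k * qpoch q q (n - k))"

definition b_part :: "nat list \<Rightarrow> complex \<Rightarrow> complex" where
  "b_part mu q = (\<Prod>i=1..part mu 1. qpoch q q (conj_part mu i - conj_part mu (i + 1)))"

text \<open>\<open>C_coeff\<close> is meant for \<open>contained nu la\<close>; then none of the natural number subtractions
  truncates.\<close>

definition C_coeff :: "nat list \<Rightarrow> nat list \<Rightarrow> complex \<Rightarrow> complex" where
  "C_coeff la nu q =
     q ^ (\<Sum>i=1..part la 1. conj_part nu (i + 1) * (conj_part la i - conj_part nu i)) *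
     (\<Prod>i=1..part la 1.
        qbinomial (conj_part la i - conj_part nu (i + 1)) (conj_part la i - conj_part nu i) q)"

text \<open>\<open>qpow_conj q mu i\<close> is \<open>q\<close> to the power of the \<open>i\<close>-th conjugate part, for \<open>|q| < 1\<close>. The 0-th
  conjugate part counts all \<open>j \<ge> 1\<close> and is infinite, hence the value 0.\<close>

definition qpow_conj :: "complex \<Rightarrow> nat list \<Rightarrow> nat \<Rightarrow> complex" where
  "qpow_conj q mu i = (if i = 0 then 0 else q ^ conj_part mu i)"

text \<open>Sums over the partitions contained in a given one are genuine finite sums.\<close>

lemma finite_contained:
  "finite {nu. is_partition nu \<and> contained nu la}"
proof (rule finite_subset)
  show "{nu. is_partition nu \<and> contained nu la}
      \<subseteq> {xs. set xs \<subseteq> {..sum_list la} \<and> length xs \<le> length la}"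
  proof (rule subsetI, intro CollectI conjI)
    fix nu assume "nu \<in> {nu. is_partition nu \<and> contained nu la}"
    then have p: "is_partition nu" and c: "contained nu la" by auto
    have le: "nu ! k \<le> part la (Suc k)" if "k < length nu" for k
    proof -
      have "part nu (Suc k) \<le> part la (Suc k)" using c by (simp add: contained_def)
      then show ?thesis using that by (simp add: part_def)
    qed
    show "length nu \<le> length la"
    proof (rule ccontr)
      assume "\<not> ?thesis"
      then have k: "length la < length nu" by simp
      then have "nu ! length la \<le> 0" using le[OF k] by (simp add: part_def)
      moreover have "nu ! length la \<in> set nu" using k by simp
      ultimately show False using p unfolding is_partition_def by force
    qed
    show "set nu \<subseteq> {..sum_list la}"
    proof
      fix x assume "x \<in> set nu"
      then obtain k where k: "k < length nu" "x = nu ! k" by (auto simp: in_set_conv_nth)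
      have "part la (Suc k) \<le> sum_list la"
        by (simp add: part_def member_le_sum_list)
      then show "x \<in> {..sum_list la}" using le[OF k(1)] k(2) by simp
    qed
  qed
  show "finite {xs. set xs \<subseteq> {..sum_list la} \<and> length xs \<le> length la}"
    by (rule finite_lists_length_le) simp
qed

end

theory Submission
  imports Defs
begin

text \<open>Write \<open>L\<^sub>i\<close>, \<open>m\<^sub>i\<close>, \<open>n\<^sub>i\<close> for the columns of \<open>\<lambda>\<close>, \<open>\<mu>\<close>, \<open>\<nu>\<close> (the parts of the conjugates). Since
  \<open>2n(\<mu>) + |\<mu>|\<close> is the sum of the \<open>m\<^sub>i\<^sup>2\<close>, and inverting \<open>q\<close> in the q-binomials of \<open>C\<close> turns its power
  of \<open>q\<close> into one with exponent the sum of \<open>n\<^sub>i\<^sup>2 - L\<^sub>i n\<^sub>i\<close>, both sides are sums over decreasing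
  sequences with the same weights \<open>z\<^sup>m q\<^sup>e\<close>, \<open>e = m\<^sup>2 - L m\<close>, for each column.

  For a single column, bounded by \<open>P\<close>, the identity is the finite Durfee-type formula \<open>durfee_finite\<close>,
  proved by induction on \<open>L\<close> and \<open>P\<close> with the q-Pascal rule. Replacing \<open>z\<close> by \<open>z q\<^sup>k\<close> and \<open>L\<close> by \<open>L - k\<close>
  shifts it to columns of length at least \<open>k\<close>, and its right hand side is again of the shape of
  one factor of the left hand side. So the columns can be summed one after the other, beginning
  with the last one. Only the first column is unbounded; there \<open>P\<close> tends to infinity.\<close>

subsection \<open>q-binomials and Gaussian weights\<close>

text \<open>For \<open>k > n\<close> the truncated \<open>n - k\<close> leaves
  \<open>qbinomial\<close> with a spurious nonzero value when \<open>|q| < 1\<close>. Vanishing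
  there lets sums run past \<open>n\<close>.\<close>

definition gbin :: "nat \<Rightarrow> nat \<Rightarrow> complex \<Rightarrow> complex" where
  "gbin n k q = (if k \<le> n then qbinomial n k q else 0)"

text \<open>The exponent \<open>m\<^sup>2 - L m\<close> may be negative, hence the quotient of two
  natural powers.\<close>

definition gwt :: "complex \<Rightarrow> complex \<Rightarrow> nat \<Rightarrow> nat \<Rightarrow> complex" where
  "gwt z q L m = z ^ m * q ^ (m\<^sup>2) / q ^ (L * m)"

lemma qpoch_0 [simp]: "qpoch a q 0 = 1"
  by (simp add: qpoch_def)

lemma qpoch_Suc: "qpoch a q (Suc k) = qpoch a q k * (1 - a * q ^ k)"
  by (simp add: qpoch_def)

lemma qpoch_Suc_shift: "qpoch a q (Suc k) = (1 - a) * qpoch (a * q) q k"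
  unfolding qpoch_def by (subst prod.lessThan_Suc_shift) (simp add: mult.assoc)

lemma qpoch_add: "qpoch a q (m + n) = qpoch a q m * qpoch (a * q ^ m) q n"
  by (induction n) (simp_all add: qpoch_Suc power_add mult.assoc)

lemma power_neq_1_of_norm_less_1:
  assumes "norm (q :: complex) < 1"
  shows "q ^ Suc n \<noteq> 1"
proof
  assume "q ^ Suc n = 1"
  then have "norm q ^ Suc n = 1" by (metis norm_one norm_power)
  moreover have "norm q ^ Suc n < 1" using assms power_Suc_less_one[of "norm q" n]
    by (cases "norm q = 0") auto
  ultimately show False by simp
qed

lemma qpoch_self_nonzero:
  assumes "norm q < 1"
  shows "qpoch q q n \<noteq> 0"
  using power_neq_1_of_norm_less_1[OF assms] unfolding qpoch_def by auto

lemma gbin_eq_0 [simp]: "n < k \<Longrightarrow> gbin n k q = 0"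
  by (simp add: gbin_def)

lemma gwt_0 [simp]: "gwt z q L 0 = 1"
  by (simp add: gwt_def)

lemma gwt_conv_power: "gwt z q L m = (z / q ^ L * q ^ m) ^ m"
  by (simp add: gwt_def power2_eq_square power_mult power_mult_distrib power_divide)

lemma prod_gwt: "(\<Prod>i\<in>I. gwt z q (L i) (m i)) = z ^ (\<Sum>i\<in>I. m i) * q ^ (\<Sum>i\<in>I. (m i)\<^sup>2) / q ^ (\<Sum>i\<in>I. L i * m i)"
  by (simp add: gwt_def prod_dividef prod.distrib power_sum)

context
  fixes q :: complex
  assumes q_nz: "q \<noteq> 0"
begin

lemma gwt_Suc_Suc: "gwt z q (Suc L) (Suc m) = z / q ^ L * gwt (z * q) q L m"
  using q_nz by (simp add: gwt_def power2_eq_square power_add power_mult_distrib field_simps)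

lemma gwt_Suc_left: "gwt z q L m = gwt z q (Suc L) m * q ^ m"
  using q_nz by (simp add: gwt_def power_add field_simps)

text \<open>The cross term \<open>2 k m\<close> of \<open>(k + m)\<^sup>2\<close> is shared out: one
  half turns \<open>z\<close> into \<open>z * q ^ k\<close>, the other lowers \<open>L\<close> to
  \<open>L - k\<close>.\<close>

lemma gwt_add:
  assumes "k \<le> L"
  shows "gwt z q L (k + m) = gwt z q L k * gwt (z * q ^ k) q (L - k) m"
proof -
  obtain d where "L = k + d" using assms le_Suc_ex by blast
  then show ?thesis
    using q_nz by (simp add: gwt_def power2_eq_square power_add power_mult_distrib algebra_simps
      flip: power_mult)
qed

lemma qpoch_inverse: "qpoch (1 / q) (1 / q) n = (\<Prod>j<n. - 1 / q ^ Suc j) * qpoch q q n"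
proof (induction n)
  case (Suc n)
  have "1 - 1 / q * (1 / q) ^ n = - 1 / q ^ Suc n * (1 - q * q ^ n)"
    using q_nz by (simp add: field_simps)
  then show ?case by (simp only: qpoch_Suc Suc prod.lessThan_Suc mult_ac)
qed simp

text \<open>Inverting \<open>q\<close> multiplies \<open>qpoch q q n\<close> by a sign and a power
  of \<open>q\<close> whose exponent is minus a triangular number. The signs cancel, and the
  triangular number of \<open>a + b\<close> exceeds those of \<open>a\<close> and \<open>b\<close>
  together by \<open>a * b\<close>.\<close>

lemma qbinomial_inverse: "qbinomial (a + b) a (1 / q) = qbinomial (a + b) b q / q ^ (a * b)"
proof -
  define e where "e n = (\<Prod>j<n. - 1 / q ^ Suc j)" for n
  have e: "e (a + b) = e a * e b / q ^ (a * b)"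
    by (induction b) (simp_all add: e_def power_add)
  have nz: "e n \<noteq> 0" for n using q_nz by (simp add: e_def)
  show ?thesis
    unfolding qbinomial_def qpoch_inverse e_def[symmetric] e using nz[of a] nz[of b] q_nz
    by (simp add: field_simps)
qed

text \<open>With \<open>a = L - n\<close> and \<open>b = n - n'\<close>, the exponents
  \<open>- n' a\<close> and \<open>- a b\<close> add up to \<open>- n a\<close>, that is
  \<open>n\<^sup>2 - L n\<close>. The next column \<open>n'\<close> survives only in the
  q-binomial.\<close>

lemma C_coeff_factor:
  assumes "n' \<le> n" "n \<le> L"
  shows "(1 / q) ^ (n' * (L - n)) * qbinomial (L - n') (L - n) (1 / q) * z ^ n
    = gwt z q L n * gbin (L - n') (n - n') q"
proof -
  obtain b where b: "n = n' + b" using assms le_Suc_ex by blast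
  obtain a where a: "L = n' + b + a" using assms le_Suc_ex b by blast
  have "qbinomial (L - n') (L - n) (1 / q) = qbinomial (a + b) b q / q ^ (a * b)"
    using qbinomial_inverse[of a b] by (simp add: a b add.commute)
  moreover have "gbin (L - n') (n - n') q = qbinomial (a + b) b q"
    by (simp add: a b gbin_def add.commute)
  moreover have "gwt z q L n = (1 / q) ^ (n' * (L - n)) * z ^ n / q ^ (a * b)"
    using q_nz by (simp add: gwt_def a b power2_eq_square power_add algebra_simps power_divide)
  ultimately show ?thesis by simp
qed

end

subsection \<open>The case of one column\<close>

context
  fixes q :: complex
  assumes q_norm: "norm q < 1"
begin

lemma gbin_0 [simp]: "gbin n 0 q = 1"
  by (simp add: gbin_def qbinomial_def qpoch_self_nonzero q_norm)

text \<open>The q-Pascal rule, for all \<open>n\<close> and \<open>k\<close> thanks to the zero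
  values. In the main case \<open>n = k + 1 + d\<close> it comes from splitting the factor
  \<open>1 - q ^ (n + 1)\<close>.\<close>

lemma gbin_Suc_Suc: "gbin (Suc n) (Suc k) q = q ^ Suc k * gbin n (Suc k) q + gbin n k q"
proof -
  note nz = qpoch_self_nonzero[OF q_norm]
  consider "n < k" | "n = k" | d where "n = Suc k + d"
    by (metis less_imp_Suc_add linorder_neqE_nat add_Suc)
  then show ?thesis
  proof cases
    case 3
    have *: "1 - q * q ^ k \<noteq> 0" "1 - q * q ^ d \<noteq> 0"
      using power_neq_1_of_norm_less_1[OF q_norm] by auto
    have 1: "gbin (Suc n) (Suc k) q = qpoch q q n * (1 - q * q ^ n) / (qpoch q q k * (1 - q * q ^ k) * (qpoch q q d * (1 - q * q ^ d)))"
      using 3 by (simp add: gbin_def qbinomial_def qpoch_Suc Suc_diff_le)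
    have 2: "gbin n (Suc k) q = qpoch q q n / (qpoch q q k * (1 - q * q ^ k) * qpoch q q d)"
      using 3 by (simp add: gbin_def qbinomial_def qpoch_Suc)
    have 4: "gbin n k q = qpoch q q n / (qpoch q q k * (qpoch q q d * (1 - q * q ^ d)))"
      using 3 by (simp add: gbin_def qbinomial_def qpoch_Suc Suc_diff_le)
    have 5: "1 - q * q ^ n = q ^ Suc k * (1 - q * q ^ d) + (1 - q * q ^ k)"
      using 3 by (simp add: algebra_simps power_add)
    have 6: "c * (e * b + a) / (x * a * (y * b)) = e * (c / (x * a * y)) + c / (x * (y * b))"
      if "a \<noteq> 0" "b \<noteq> 0" "x \<noteq> 0" "y \<noteq> 0" for a b c e x y :: complex
      using that by (simp add: field_simps)
    show ?thesis unfolding 1 2 4 5 by (rule 6) (use * nz in simp_all)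
  qed (use nz in \<open>auto simp: gbin_def qbinomial_def\<close>)
qed

lemma gbin_absorb: "(1 - q ^ Suc k) * gbin (Suc n) (Suc k) q = (1 - q ^ Suc n) * gbin n k q"
  using power_neq_1_of_norm_less_1[OF q_norm, of k]
  by (auto simp: gbin_def qbinomial_def qpoch_Suc divide_simps)

text \<open>Formally divided by \<open>(zq;q)_M\<close>, this sorts the partitions with parts at
  most \<open>M\<close> by the side \<open>m\<close> of their Durfee square, with \<open>z\<close>
  marking the number of parts. The proof is algebraic: q-Pascal splits each term, and the pieces
  regroup into the terms for \<open>M\<close> and \<open>z * q\<close>.\<close>

lemma durfee_finite_zero: "(\<Sum>m\<le>M. gwt z q 0 m * gbin M m q * qpoch (z * q ^ Suc m) q (M - m)) = 1"
proof (induction M arbitrary: z)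
  case (Suc M)
  let ?X = "\<lambda>m. gwt (z * q) q 0 m * gbin M m q * qpoch (z * q * q ^ Suc m) q (M - m)"
  let ?S = "\<lambda>m. gwt z q 0 m * gbin (Suc M) m q * qpoch (z * q ^ Suc m) q (Suc M - m)"
  have 1: "?S (Suc m) = ?X (Suc m) * (1 - z * q ^ Suc (Suc m)) + ?X m * (z * q ^ Suc m)" if "m \<le> M" for m
  \<comment> \<open>For \<open>m = M\<close> the difference \<open>M - m\<close> is not a successor,
    and \<open>?X (Suc m)\<close> vanishes.\<close>
  proof (cases "m = M")
    case True
    then show ?thesis
      by (simp add: gbin_Suc_Suc gwt_def power2_eq_square power_add power_mult_distrib algebra_simps)
  next
    case False
    with that have d: "Suc M - Suc m = Suc (M - Suc m)" "M - m = Suc (M - Suc m)" by simp_all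
    have a: "z * q ^ Suc (Suc m) * q = z * q * q ^ Suc (Suc m)"
      "z * q * q ^ Suc m = z * q ^ Suc (Suc m)" by simp_all
    have "?S (Suc m) = gwt z q 0 (Suc m) * (q ^ Suc m * gbin M (Suc m) q + gbin M m q) *
       qpoch (z * q ^ Suc (Suc m)) q (M - m)"
      by (simp only: gbin_Suc_Suc) simp
    also have "\<dots> = (gwt z q 0 (Suc m) * q ^ Suc m) * gbin M (Suc m) q * qpoch (z * q ^ Suc (Suc m)) q (Suc (M - Suc m))
       + gwt z q 0 (Suc m) * gbin M m q * qpoch (z * q ^ Suc (Suc m)) q (M - m)"
      unfolding d(2) by (simp add: algebra_simps)
    also have "\<dots> = ?X (Suc m) * (1 - z * q ^ Suc (Suc m)) + ?X m * (z * q ^ Suc m)"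
    proof -
      have "gwt z q 0 (Suc m) * q ^ Suc m = gwt (z * q) q 0 (Suc m)"
        by (simp add: gwt_def power_mult_distrib)
      moreover have "gwt z q 0 (Suc m) = gwt (z * q) q 0 m * (z * q ^ Suc m)"
        by (simp add: gwt_def power2_eq_square power_add power_mult_distrib algebra_simps)
      moreover have "qpoch (z * q ^ Suc (Suc m)) q (Suc (M - Suc m)) = (1 - z * q ^ Suc (Suc m)) * qpoch (z * q * q ^ Suc (Suc m)) q (M - Suc m)"
        unfolding qpoch_Suc_shift a ..
      ultimately show ?thesis unfolding a(2) by (simp only: mult_ac)
    qed
    finally show ?thesis .
  qed
  have 2: "(\<Sum>m\<le>M. ?S (Suc m)) = (\<Sum>m\<le>M. ?X (Suc m) * (1 - z * q ^ Suc (Suc m))) + (\<Sum>m\<le>M. ?X m * (z * q ^ Suc m))"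
    unfolding sum.distrib[symmetric] by (rule sum.cong[OF refl]) (simp only: 1 atMost_iff)
  have 3: "?S 0 = ?X 0 * (1 - z * q ^ Suc 0)"
    by (simp add: qpoch_Suc_shift mult_ac)
  have "(\<Sum>m\<le>Suc M. ?S m) = ?S 0 + (\<Sum>m\<le>M. ?S (Suc m))"
    by (rule sum.atMost_Suc_shift)
  also have "\<dots> = ?X 0 * (1 - z * q ^ Suc 0) + (\<Sum>m\<le>M. ?X (Suc m) * (1 - z * q ^ Suc (Suc m))) + (\<Sum>m\<le>M. ?X m * (z * q ^ Suc m))"
    unfolding 2 3 by (simp only: add.assoc)
  also have "?X 0 * (1 - z * q ^ Suc 0) + (\<Sum>m\<le>M. ?X (Suc m) * (1 - z * q ^ Suc (Suc m))) = (\<Sum>m\<le>Suc M. ?X m * (1 - z * q ^ Suc m))"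
    by (rule sum.atMost_Suc_shift[symmetric])
  \<comment> \<open>The top term \<open>?X (Suc M)\<close> is zero. In the two remaining sums
    \<open>?X m\<close> has the coefficients \<open>1 - z * q ^ Suc m\<close> and
    \<open>z * q ^ Suc m\<close>, which add up to 1.\<close>
  also have "\<dots> = (\<Sum>m\<le>M. ?X m * (1 - z * q ^ Suc m))" by simp
  also have "\<dots> + (\<Sum>m\<le>M. ?X m * (z * q ^ Suc m)) = (\<Sum>m\<le>M. ?X m)"
    unfolding sum.distrib[symmetric] by (simp add: algebra_simps)
  finally show ?case using Suc.IH[of "z * q"] by simp
qed simp

section \<open>Bounds and limits of q-Pochhammer symbols, weights and q-binomials\<close>

lemma summable_geometric_scaled: "summable (\<lambda>j. norm a * norm q ^ j)" for a :: complex
  using q_norm by (intro summable_mult summable_geometric) simp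

text \<open>The inequality \<open>1 + x \<le> exp x\<close> and a geometric series give a bound
  independent of \<open>k\<close>, as dominated convergence will require.\<close>

lemma norm_qpoch_le: "norm (qpoch a q k) \<le> exp (norm a / (1 - norm q))"
proof -
  have "norm (qpoch a q k) = (\<Prod>j<k. norm (1 - a * q ^ j))"
    by (simp add: qpoch_def prod_norm)
  also have "\<dots> \<le> (\<Prod>j<k. 1 + norm a * norm q ^ j)"
  proof (rule prod_mono)
    fix j show "0 \<le> norm (1 - a * q ^ j) \<and> norm (1 - a * q ^ j) \<le> 1 + norm a * norm q ^ j"
      using norm_triangle_ineq4[of 1 "a * q ^ j"] by (simp add: norm_mult norm_power)
  qed
  also have "\<dots> \<le> exp (\<Sum>j<k. norm a * norm q ^ j)"
    by (rule prod_le_exp_sum) simp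
  also have "(\<Sum>j<k. norm a * norm q ^ j) \<le> (\<Sum>j. norm a * norm q ^ j)"
    by (intro sum_le_suminf summable_geometric_scaled) auto
  also have "\<dots> = norm a / (1 - norm q)"
    using q_norm by (subst suminf_mult) (simp_all add: suminf_geometric summable_geometric)
  finally show ?thesis by simp
qed

lemma convergent_prod_qpoch: "convergent_prod (\<lambda>j. 1 - a * q ^ j)"
  using summable_geometric_scaled[of a]
  by (intro abs_convergent_prod_imp_convergent_prod summable_imp_abs_convergent_prod)
    (simp add: norm_mult norm_power)

lemma qpoch_LIMSEQ: "(\<lambda>k. qpoch a q k) \<longlonglongrightarrow> qpoch_inf a q"
  using convergent_prod_LIMSEQ[OF convergent_prod_qpoch[of a]]
  unfolding qpoch_def qpoch_inf_def lessThan_Suc_atMost[symmetric]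
  by (rule LIMSEQ_imp_Suc)

lemma norm_qpoch_inf_le: "norm (qpoch_inf a q) \<le> exp (norm a / (1 - norm q))"
  by (rule LIMSEQ_le_const2[OF tendsto_norm[OF qpoch_LIMSEQ]]) (use norm_qpoch_le in blast)

lemma qpoch_inf_split: "qpoch_inf a q = qpoch a q k * qpoch_inf (a * q ^ k) q"
proof -
  have "(\<lambda>n. qpoch a q (n + k)) \<longlonglongrightarrow> qpoch_inf a q"
    by (rule LIMSEQ_ignore_initial_segment[OF qpoch_LIMSEQ])
  moreover have "(\<lambda>n. qpoch a q (n + k)) \<longlonglongrightarrow> qpoch a q k * qpoch_inf (a * q ^ k) q"
    unfolding add.commute[of _ k] qpoch_add by (intro tendsto_intros qpoch_LIMSEQ)
  ultimately show ?thesis by (rule LIMSEQ_unique)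
qed

lemma qpoch_inf_self_nonzero: "qpoch_inf q q \<noteq> 0"
  unfolding qpoch_inf_def
  using power_neq_1_of_norm_less_1[OF q_norm] by (intro prodinf_nonzero convergent_prod_qpoch) auto

text \<open>The reciprocals converge because the limit \<open>qpoch_inf q q\<close> is nonzero. This
  controls the denominators \<open>qpoch q q n\<close> uniformly.\<close>

lemma inverse_qpoch_self_bounded:
  obtains C where "C \<ge> 1" "\<And>n. norm (1 / qpoch q q n) \<le> C"
proof -
  have "(\<lambda>n. 1 / qpoch q q n) \<longlonglongrightarrow> 1 / qpoch_inf q q"
    by (intro tendsto_intros qpoch_LIMSEQ qpoch_inf_self_nonzero)
  then have "Bseq (\<lambda>n. 1 / qpoch q q n)"
    using convergentI convergent_imp_Bseq by blast
  then obtain K where "\<And>n. norm (1 / qpoch q q n) \<le> K"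
    unfolding Bseq_def by blast
  then show ?thesis by (intro that[of "max 1 K"]) (simp_all only: le_max_iff_disj order_refl simp_thms)
qed

text \<open>As an \<open>m\<close>-th power, the weight has the base
  \<open>z / q ^ L * q ^ m\<close>, which tends to 0, so its norm is eventually below
  \<open>(1 / 2) ^ m\<close>.\<close>

lemma summable_norm_gwt: "summable (\<lambda>m. norm (gwt z q L m))"
proof (rule summable_comparison_test_ev)
  have "(\<lambda>m. norm (z / q ^ L * q ^ m)) \<longlonglongrightarrow> norm (z / q ^ L * 0)"
    by (intro tendsto_intros LIMSEQ_power_zero q_norm)
  then have "eventually (\<lambda>m. norm (z / q ^ L * q ^ m) < 1 / 2) sequentially"
    by (rule order_tendstoD) simp
  then show "eventually (\<lambda>m. norm (norm (gwt z q L m)) \<le> (1 / 2) ^ m) sequentially"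
  proof eventually_elim
    case (elim m)
    then have "norm (gwt z q L m) \<le> (1 / 2) ^ m"
      unfolding gwt_conv_power norm_power by (intro power_mono) simp_all
    then show ?case by simp
  qed
qed (simp add: summable_geometric)

text \<open>After shifting \<open>M\<close> by \<open>m\<close>, the numerator and one factor of the
  denominator have the same nonzero limit.\<close>

lemma gbin_LIMSEQ: "(\<lambda>M. gbin M m q) \<longlonglongrightarrow> 1 / qpoch q q m"
proof (rule LIMSEQ_offset[where k = m])
  have "(\<lambda>M. qpoch q q (M + m) / (qpoch q q m * qpoch q q M)) \<longlonglongrightarrow>
      qpoch_inf q q / (qpoch q q m * qpoch_inf q q)"
    using qpoch_inf_self_nonzero qpoch_self_nonzero[OF q_norm]
    by (intro tendsto_intros qpoch_LIMSEQ LIMSEQ_ignore_initial_segment) auto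
  then show "(\<lambda>M. gbin (M + m) m q) \<longlonglongrightarrow> 1 / qpoch q q m"
    using qpoch_inf_self_nonzero by (simp add: gbin_def qbinomial_def)
qed

section \<open>The one-column identities\<close>

context
  assumes q_nz: "q \<noteq> 0"
begin

text \<open>Both sides, as functions \<open>F L M z\<close>, satisfy
  \<open>F (L + 1) (N + 1) z = F L (N + 1) z + c * F L N (z * q)\<close> with
  \<open>c = z / q ^ L * (1 - q ^ (N + 1))\<close>. For \<open>L = 0\<close> only the term
  \<open>n = 0\<close> remains on the right.\<close>

lemma durfee_finite:
  "(\<Sum>m\<le>M. gwt z q L m * gbin M m q * qpoch (z * q ^ Suc m) q (M - m))
     = (\<Sum>n\<le>M. gwt z q L n * gbin L n q * gbin M n q * qpoch q q n)"
proof (induction L arbitrary: M z)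
  case 0
  have "(\<Sum>n\<le>M. gwt z q 0 n * gbin 0 n q * gbin M n q * qpoch q q n) =
     (\<Sum>n\<in>{0}. gwt z q 0 n * gbin 0 n q * gbin M n q * qpoch q q n)"
    by (rule sum.mono_neutral_right) auto
  then show ?case unfolding durfee_finite_zero by simp
next
  case (Suc L)
  show ?case
  proof (cases M)
    case 0
    then show ?thesis by simp
  next
    case (Suc N)
    define c where "c = z / q ^ L * (1 - q ^ Suc N)"
    let ?S = "\<lambda>L m. gwt z q L m * gbin (Suc N) m q * qpoch (z * q ^ Suc m) q (Suc N - m)"
    let ?S' = "\<lambda>m. gwt (z * q) q L m * gbin N m q * qpoch (z * q * q ^ Suc m) q (N - m)"
    let ?R = "\<lambda>L m. gwt z q L m * gbin L m q * gbin (Suc N) m q * qpoch q q m"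
    let ?R' = "\<lambda>m. gwt (z * q) q L m * gbin L m q * gbin N m q * qpoch q q m"
    \<comment> \<open>Split \<open>1 = q ^ Suc m + (1 - q ^ Suc m)\<close>: the first part turns the
      weight for \<open>Suc L\<close> into that for \<open>L\<close>; the second is absorbed by the
      q-binomial, lowering \<open>Suc N\<close> to \<open>N\<close>.\<close>
    have s: "?S (Suc L) (Suc m) = ?S L (Suc m) + c * ?S' m" for m
    proof -
      have "?S (Suc L) (Suc m) = ?S L (Suc m) + gwt z q (Suc L) (Suc m) * ((1 - q ^ Suc m) * gbin (Suc N) (Suc m) q) * qpoch (z * q ^ Suc (Suc m)) q (N - m)"
        unfolding gwt_Suc_left[OF q_nz, of z L "Suc m"] by (simp add: algebra_simps)
      then show ?thesis unfolding gwt_Suc_Suc[OF q_nz] gbin_absorb c_def by (simp add: mult_ac)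
    qed
    \<comment> \<open>Here the split is the q-Pascal rule for \<open>gbin (Suc L) (Suc m) q\<close>,
      and the factor to absorb is the last one of \<open>qpoch q q (Suc m)\<close>.\<close>
    have r: "?R (Suc L) (Suc m) = ?R L (Suc m) + c * ?R' m" for m
    proof -
      have "?R (Suc L) (Suc m) = ?R L (Suc m) + gwt z q (Suc L) (Suc m) * gbin L m q * ((1 - q ^ Suc m) * gbin (Suc N) (Suc m) q) * qpoch q q m"
        unfolding gwt_Suc_left[OF q_nz, of z L "Suc m"] gbin_Suc_Suc[of L] by (simp add: qpoch_Suc algebra_simps)
      then show ?thesis unfolding gwt_Suc_Suc[OF q_nz] gbin_absorb c_def by (simp add: mult_ac)
    qed
    have "(\<Sum>m\<le>Suc N. ?S (Suc L) m) = (\<Sum>m\<le>Suc N. ?S L m) + c * (\<Sum>m\<le>N. ?S' m)"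
      by (simp only: sum.atMost_Suc_shift s sum.distrib sum_distrib_left) simp
    also have "\<dots> = (\<Sum>m\<le>Suc N. ?R L m) + c * (\<Sum>m\<le>N. ?R' m)"
      by (simp only: Suc.IH)
    also have "\<dots> = (\<Sum>m\<le>Suc N. ?R (Suc L) m)"
      by (simp only: sum.atMost_Suc_shift r sum.distrib sum_distrib_left) simp
    finally show ?thesis using \<open>M = Suc N\<close> by simp
  qed
qed

text \<open>Let \<open>M\<close> tend to infinity in \<open>durfee_finite\<close>: on the left by
  Tannery's theorem, on the right in a sum of fixed length, where
  \<open>gbin M n q * qpoch q q n\<close> tends to 1.\<close>

lemma durfee_infinite:
  "((\<lambda>m. gwt z q L m / qpoch q q m * qpoch_inf (z * q ^ Suc m) q)
     has_sum (\<Sum>n\<le>L. gwt z q L n * gbin L n q)) UNIV"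
proof -
  define a where "a m M = gwt z q L m * gbin M m q * qpoch (z * q ^ Suc m) q (M - m)" for m M
  define b where "b m = gwt z q L m * (1 / qpoch q q m) * qpoch_inf (z * q ^ Suc m) q" for m
  obtain C where C: "C \<ge> 1" "\<And>n. norm (1 / qpoch q q n) \<le> C"
    using inverse_qpoch_self_bounded by blast
  \<comment> \<open>\<open>K\<close> bounds all q-binomials: the exponential is for the numerator,
    and one \<open>C\<close> for each factor of the denominator.\<close>
  define K where "K = exp (norm q / (1 - norm q)) * (C * C)"
  have K: "norm (gbin M m q) \<le> K" for M m
  proof (cases "m \<le> M")
    case True
    then have "norm (gbin M m q) = norm (qpoch q q M) * (norm (1 / qpoch q q m) * norm (1 / qpoch q q (M - m)))"
      by (simp add: gbin_def qbinomial_def norm_divide norm_mult)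
    also have "\<dots> \<le> K" unfolding K_def
      using C by (intro mult_mono norm_qpoch_le) auto
    finally show ?thesis .
  next
    case False
    then show ?thesis using C by (simp add: gbin_def K_def)
  qed
  define E where "E = exp (norm z / (1 - norm q))"
  have E: "norm (qpoch (z * q ^ Suc m) q k) \<le> E" for m k
  proof -
    have "norm (z * q ^ Suc m) \<le> norm z"
      using q_norm unfolding norm_mult norm_power by (intro mult_left_le power_le_one) auto
    then have "norm (z * q ^ Suc m) / (1 - norm q) \<le> norm z / (1 - norm q)"
      using q_norm by (intro divide_right_mono) auto
    then show ?thesis unfolding E_def by (intro order_trans[OF norm_qpoch_le]) simp
  qed
  have lim: "a m \<longlonglongrightarrow> b m" for m
  proof -
    have "(\<lambda>M. qpoch (z * q ^ Suc m) q (M - m)) \<longlonglongrightarrow> qpoch_inf (z * q ^ Suc m) q"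
      by (rule LIMSEQ_offset[where k = m]) (use qpoch_LIMSEQ in simp)
    then show ?thesis unfolding a_def b_def by (intro tendsto_intros gbin_LIMSEQ)
  qed
  \<comment> \<open>This majorant does not depend on \<open>M\<close> and is summable in
    \<open>m\<close>.\<close>
  have bound: "norm (a m M) \<le> norm (gwt z q L m) * (K * E)" for m M
    unfolding a_def norm_mult mult.assoc
    by (intro mult_left_mono mult_mono K E norm_ge_zero order_trans[OF norm_ge_zero K])
  have tan: "eventually (\<lambda>M. summable (\<lambda>m. norm (a m M))) sequentially \<and>
      summable (\<lambda>m. norm (b m)) \<and> ((\<lambda>M. suminf (\<lambda>m. a m M)) \<longlonglongrightarrow> suminf b)"
    by (rule tannerys_theorem[where M = "\<lambda>m. norm (gwt z q L m) * (K * E)"])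
      (simp_all only: lim bound summable_mult2 summable_norm_gwt case_prod_unfold eventually_True
        sequentially_bot not_False_eq_True)
  let ?S = "\<Sum>n\<le>L. gwt z q L n * gbin L n q"
  have "(\<lambda>M. suminf (\<lambda>m. a m M)) \<longlonglongrightarrow> ?S"
  proof -
    have "(\<lambda>M. \<Sum>n\<le>L. gwt z q L n * gbin L n q * gbin M n q * qpoch q q n) \<longlonglongrightarrow>
        (\<Sum>n\<le>L. gwt z q L n * gbin L n q * (1 / qpoch q q n) * qpoch q q n)"
      by (intro tendsto_intros gbin_LIMSEQ)
    then have "(\<lambda>M. \<Sum>n\<le>L. gwt z q L n * gbin L n q * gbin M n q * qpoch q q n) \<longlonglongrightarrow> ?S"
      using qpoch_self_nonzero[OF q_norm] by simp
    moreover have "eventually (\<lambda>M. (\<Sum>n\<le>L. gwt z q L n * gbin L n q * gbin M n q * qpoch q q n)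
        = suminf (\<lambda>m. a m M)) sequentially"
      using eventually_ge_at_top[of L]
    proof eventually_elim
      case (elim M)
      \<comment> \<open>The q-binomial vanishes for \<open>m > M\<close>, so the series is the left
        hand side of \<open>durfee_finite\<close>.\<close>
      have "suminf (\<lambda>m. a m M) = (\<Sum>m\<le>M. a m M)"
        by (rule suminf_finite) (auto simp: a_def gbin_def)
      also have "\<dots> = (\<Sum>n\<le>M. gwt z q L n * gbin L n q * gbin M n q * qpoch q q n)"
        unfolding a_def by (rule durfee_finite)
      also have "\<dots> = (\<Sum>n\<le>L. gwt z q L n * gbin L n q * gbin M n q * qpoch q q n)"
        using elim by (intro sum.mono_neutral_right) (auto simp: gbin_def)
      finally show ?case ..
    qed
    ultimately show ?thesis by (rule Lim_transform_eventually)
  qed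
  then have "suminf b = ?S" using tan LIMSEQ_unique by blast
  moreover have "b sums suminf b" using tan summable_norm_cancel summable_sums by blast
  ultimately have "(b has_sum ?S) UNIV" using tan norm_summable_imp_has_sum by metis
  then show ?thesis unfolding b_def by simp
qed

text \<open>Writing \<open>m + k\<close> for \<open>m\<close> pulls out the constant
  \<open>gwt z q L k\<close> and leaves \<open>durfee_infinite\<close> for \<open>z * q ^ k\<close>
  and \<open>L - k\<close>. Later \<open>k\<close> is the second column of \<nu>, and the divisor
  comes from the columns of \<mu> already summed.\<close>

lemma durfee_infinite_shift:
  assumes "k \<le> L"
  shows "((\<lambda>m. gwt z q L m / qpoch q q (m - k) * qpoch_inf (z * q ^ Suc m) q)
     has_sum (\<Sum>n=k..L. gwt z q L n * gbin (L - k) (n - k) q)) {k..}"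
proof -
  let ?f = "\<lambda>m. gwt z q L m / qpoch q q (m - k) * qpoch_inf (z * q ^ Suc m) q"
  have eq: "gwt z q L (m + k) = gwt z q L k * gwt (z * q ^ k) q (L - k) m" for m
    using gwt_add[OF q_nz assms, of z m] by (simp add: add.commute)
  have "((\<lambda>m. gwt z q L k * (gwt (z * q ^ k) q (L - k) m / qpoch q q m * qpoch_inf (z * q ^ k * q ^ Suc m) q))
     has_sum (gwt z q L k * (\<Sum>n\<le>L - k. gwt (z * q ^ k) q (L - k) n * gbin (L - k) n q))) UNIV"
    by (intro has_sum_cmult_right durfee_infinite)
  also have "(\<lambda>m. gwt z q L k * (gwt (z * q ^ k) q (L - k) m / qpoch q q m * qpoch_inf (z * q ^ k * q ^ Suc m) q))
     = ?f \<circ> (\<lambda>m. m + k)"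
    by (auto simp: eq power_add mult_ac)
  also have "gwt z q L k * (\<Sum>n\<le>L - k. gwt (z * q ^ k) q (L - k) n * gbin (L - k) n q)
     = (\<Sum>n=0..L-k. gwt z q L (n + k) * gbin (L - k) (n + k - k) q)"
    by (simp add: sum_distrib_left eq atLeast0AtMost mult.assoc)
  also have "\<dots> = (\<Sum>n=k..L. gwt z q L n * gbin (L - k) (n - k) q)"
    using assms sum.shift_bounds_cl_nat_ivl[of "\<lambda>n. gwt z q L n * gbin (L - k) (n - k) q" 0 k "L - k"] by simp
  finally have "(?f has_sum (\<Sum>n=k..L. gwt z q L n * gbin (L - k) (n - k) q)) (range (\<lambda>m. m + k))"
    by (simp only: has_sum_reindex inj_on_def add_right_cancel simp_thms ball_simps)
  moreover have "range (\<lambda>m. m + k) = {k..}"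
    by (auto simp: image_iff) (metis le_add_diff_inverse2)
  ultimately show ?thesis by simp
qed

text \<open>The same shift of \<open>durfee_finite\<close>, with \<open>M = P - k\<close>, divided
  by \<open>qpoch q q M\<close> and multiplied by \<open>qpoch_inf (z * q ^ Suc P) q\<close>, which
  completes each finite q-Pochhammer symbol to an infinite one. The divisor
  \<open>qpoch q q (P - n)\<close> on the right has the form of \<open>qpoch q q (m - k)\<close>,
  ready for the preceding column.\<close>

lemma durfee_finite_shift:
  assumes "k \<le> L" "k \<le> P"
  shows "(\<Sum>m=k..P. gwt z q L m / (qpoch q q (m - k) * qpoch q q (P - m)) * qpoch_inf (z * q ^ Suc m) q)
     = qpoch_inf (z * q ^ Suc P) q * (\<Sum>n=k..P. gwt z q L n * gbin (L - k) (n - k) q / qpoch q q (P - n))"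
proof -
  obtain M where M: "P = M + k" using assms(2) by (metis le_add_diff_inverse2)
  note nz = qpoch_self_nonzero[OF q_norm]
  have eq: "gwt z q L (m + k) = gwt z q L k * gwt (z * q ^ k) q (L - k) m" for m
    using gwt_add[OF q_nz assms(1), of z m] by (simp add: add.commute)
  have sh: "sum g {k..P} = (\<Sum>i\<le>M. g (i + k))" for g :: "nat \<Rightarrow> complex"
    using sum.shift_bounds_cl_nat_ivl[of g 0 k M] by (simp add: atLeast0AtMost M)
  define w where "w = z * q ^ k"
  have split: "qpoch_inf (z * q ^ Suc (m + k)) q = qpoch (w * q ^ Suc m) q (M - m) * qpoch_inf (z * q ^ Suc P) q"
    if "m \<le> M" for m
  proof -
    have "Suc (m + k) + (M - m) = Suc P" using that M by simp
    then have "z * q ^ Suc (m + k) * q ^ (M - m) = z * q ^ Suc P" by (simp only: mult.assoc flip: power_add)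
    then show ?thesis using qpoch_inf_split[of "z * q ^ Suc (m + k)" "M - m"]
      unfolding w_def by (simp only:) (simp add: power_add mult_ac)
  qed
  have gb: "gbin M m q / qpoch q q M = 1 / (qpoch q q m * qpoch q q (M - m))" if "m \<le> M" for m
    using that nz by (simp add: gbin_def qbinomial_def)
  have "(\<Sum>m=k..P. gwt z q L m / (qpoch q q (m - k) * qpoch q q (P - m)) * qpoch_inf (z * q ^ Suc m) q)
    = (\<Sum>m\<le>M. gwt z q L (m + k) / (qpoch q q m * qpoch q q (M - m)) * qpoch_inf (z * q ^ Suc (m + k)) q)"
    unfolding sh using M by simp
  also have "\<dots> = (\<Sum>m\<le>M. gwt z q L k / qpoch q q M * qpoch_inf (z * q ^ Suc P) q *
      (gwt w q (L - k) m * gbin M m q * qpoch (w * q ^ Suc m) q (M - m)))"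
  proof (rule sum.cong[OF refl])
    fix m assume "m \<in> {..M}"
    then have "m \<le> M" by simp
    have "gwt z q L (m + k) / (qpoch q q m * qpoch q q (M - m)) = gwt z q L k * gwt w q (L - k) m * (gbin M m q / qpoch q q M)"
      unfolding gb[OF \<open>m \<le> M\<close>] eq w_def by simp
    then show "gwt z q L (m + k) / (qpoch q q m * qpoch q q (M - m)) * qpoch_inf (z * q ^ Suc (m + k)) q
      = gwt z q L k / qpoch q q M * qpoch_inf (z * q ^ Suc P) q *
      (gwt w q (L - k) m * gbin M m q * qpoch (w * q ^ Suc m) q (M - m))"
      unfolding split[OF \<open>m \<le> M\<close>] by (simp add: mult_ac)
  qed
  also have "\<dots> = gwt z q L k / qpoch q q M * qpoch_inf (z * q ^ Suc P) q *
      (\<Sum>n\<le>M. gwt w q (L - k) n * gbin (L - k) n q * gbin M n q * qpoch q q n)"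
    unfolding sum_distrib_left[symmetric] durfee_finite ..
  also have "\<dots> = qpoch_inf (z * q ^ Suc P) q * (\<Sum>n\<le>M. gwt z q L (n + k) * gbin (L - k) n q / qpoch q q (M - n))"
    unfolding sum_distrib_left
  proof (rule sum.cong[OF refl])
    fix n assume "n \<in> {..M}"
    then have "gbin M n q * qpoch q q n = qpoch q q M / qpoch q q (M - n)"
      using nz by (simp add: gbin_def qbinomial_def)
    then show "gwt z q L k / qpoch q q M * qpoch_inf (z * q ^ Suc P) q * (gwt w q (L - k) n * gbin (L - k) n q * gbin M n q * qpoch q q n)
      = qpoch_inf (z * q ^ Suc P) q * (gwt z q L (n + k) * gbin (L - k) n q / qpoch q q (M - n))"
      using nz unfolding eq w_def mult.assoc by (simp add: field_simps)
  qed
  also have "(\<Sum>n\<le>M. gwt z q L (n + k) * gbin (L - k) n q / qpoch q q (M - n))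
    = (\<Sum>n=k..P. gwt z q L n * gbin (L - k) (n - k) q / qpoch q q (P - n))"
    unfolding sh using M by simp
  finally show ?thesis .
qed

end

end

subsection \<open>Iteration over the columns\<close>

definition dec_lists :: "nat \<Rightarrow> nat \<Rightarrow> nat list set" where
  "dec_lists n P = {ms. length ms = n \<and> sorted_wrt (\<ge>) (P # ms)}"

lemma dec_lists_0 [simp]: "dec_lists 0 P = {[]}"
  by (auto simp: dec_lists_def)

lemma dec_lists_Suc: "dec_lists (Suc n) P = (\<Union>m\<le>P. (#) m ` dec_lists n m)"
proof (intro equalityI subsetI)
  fix ms assume "ms \<in> dec_lists (Suc n) P"
  then show "ms \<in> (\<Union>m\<le>P. (#) m ` dec_lists n m)"
    by (cases ms) (auto simp: dec_lists_def)
qed (force simp: dec_lists_def)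

lemma finite_dec_lists [simp]: "finite (dec_lists n P)"
  by (induction n arbitrary: P) (simp_all add: dec_lists_Suc)

lemma sum_dec_lists_Suc:
  "(\<Sum>ms\<in>dec_lists (Suc n) P. f ms) = (\<Sum>m\<le>P. \<Sum>ms\<in>dec_lists n m. f (m # ms))"
  unfolding dec_lists_Suc
  by (subst sum.UNION_disjoint) (auto simp: sum.reindex)

text \<open>The default 0 is the right length for the column after the last one.\<close>

fun hd0 :: "nat list \<Rightarrow> nat" where
  "hd0 [] = 0"
| "hd0 (n # ns) = n"

text \<open>The lists \<open>L # Ls\<close>, \<open>m # ms\<close> and \<open>n # ns\<close> hold consecutive columns of \<open>\<lambda>\<close>, \<open>\<mu>\<close> and \<open>\<nu>\<close>, and \<open>P\<close> is
  the column of \<open>\<mu>\<close> just before \<open>m\<close>.\<close>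

fun lweight :: "complex \<Rightarrow> complex \<Rightarrow> nat list \<Rightarrow> nat \<Rightarrow> nat list \<Rightarrow> complex" where
  "lweight z q (L # Ls) P (m # ms) = gwt z q L m / qpoch q q (P - m) * lweight z q Ls m ms"
| "lweight z q _ P _ = qpoch_inf (z * q ^ Suc P) q / qpoch q q P"

fun rweight :: "complex \<Rightarrow> complex \<Rightarrow> nat list \<Rightarrow> nat list \<Rightarrow> complex" where
  "rweight z q (L # Ls) (n # ns) = gwt z q L n * gbin (L - hd0 ns) (n - hd0 ns) q * rweight z q Ls ns"
| "rweight z q _ _ = 1"

text \<open>\<open>rsum z q Ls n\<close> is the sum of \<open>rweight z q Ls ns\<close> over the decreasing \<open>ns\<close> with head \<open>n\<close>.\<close>

fun rsum :: "complex \<Rightarrow> complex \<Rightarrow> nat list \<Rightarrow> nat \<Rightarrow> complex" where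
  "rsum z q [] n = (if n = 0 then 1 else 0)"
| "rsum z q (L # Ls) n = gwt z q L n * (\<Sum>k\<le>n. gbin (L - k) (n - k) q * rsum z q Ls k)"

text \<open>Up to a constant, a majorant for \<open>lweight\<close> that factors over the
  columns.\<close>

fun gwts :: "complex \<Rightarrow> complex \<Rightarrow> nat list \<Rightarrow> nat list \<Rightarrow> real" where
  "gwts z q (L # Ls) (m # ms) = norm (gwt z q L m) * gwts z q Ls ms"
| "gwts z q _ _ = 1"

text \<open>For \<open>k \<le> L < n\<close> the q-binomial vanishes. For \<open>k > L\<close> the
  difference \<open>L - k\<close> truncates, but then \<open>k\<close> exceeds the head of
  \<open>Ls\<close> and induction applies.\<close>

lemma rsum_eq_0:
  assumes "sorted_wrt (\<ge>) Ls" "hd0 Ls < n"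
  shows "rsum z q Ls n = 0"
  using assms
proof (induction Ls arbitrary: n)
  case (Cons L Ls)
  have "gbin (L - k) (n - k) q * rsum z q Ls k = 0" if "k \<le> n" for k
  proof (cases "k \<le> L")
    case True
    then show ?thesis using Cons.prems by (simp add: gbin_def)
  next
    case False
    then have "hd0 Ls < k" using Cons.prems by (cases Ls) auto
    then show ?thesis using Cons by simp
  qed
  then show ?case by (simp add: sum.neutral)
qed simp

text \<open>At the last column with \<open>n > L\<close>, the following one still satisfies
  \<open>hd0 ns \<le> L\<close>, so the q-binomial vanishes. Hence only the \<nu> contained in
  \<lambda> contribute.\<close>

lemma rweight_eq_0:
  assumes "sorted_wrt (\<ge>) Ls" "length ns = length Ls" "\<not> list_all2 (\<le>) ns Ls"
  shows "rweight z q Ls ns = 0"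
  using assms
proof (induction z q Ls ns rule: rweight.induct)
  case (1 z q L Ls n ns)
  show ?case
  proof (cases "list_all2 (\<le>) ns Ls")
    case True
    then have "hd0 ns \<le> L" using "1.prems" by (cases ns; cases Ls) auto
    then show ?thesis using True "1.prems" by (simp add: gbin_def)
  next
    case False
    then show ?thesis using 1 by simp
  qed
qed auto

text \<open>The arbitrary \<open>f\<close> makes the induction work: it becomes the q-binomial that
  links the previous column to the head.\<close>

lemma sum_rweight:
  "(\<Sum>ns\<in>dec_lists (length Ls) P. f (hd0 ns) * rweight z q Ls ns) = (\<Sum>n\<le>P. f n * rsum z q Ls n)"
proof (induction Ls arbitrary: P f)
  case Nil
  have "(\<Sum>n\<le>P. f n * rsum z q [] n) = (\<Sum>n\<in>{0}. f n * rsum z q [] n)"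
    by (rule sum.mono_neutral_right) auto
  then show ?case by simp
next
  case (Cons L Ls)
  have "(\<Sum>ns\<in>dec_lists (length Ls) n. f n * rweight z q (L # Ls) (n # ns)) = f n * rsum z q (L # Ls) n" for n
    using Cons.IH[of "\<lambda>k. gbin (L - k) (n - k) q" n]
    by (simp add: sum_distrib_left[symmetric] mult.assoc)
  then show ?case by (simp add: sum_dec_lists_Suc del: rsum.simps rweight.simps)
qed

lemma has_sum_finite_sum:
  fixes f :: "'k \<Rightarrow> 'a \<Rightarrow> complex"
  assumes "finite K" "\<And>k. k \<in> K \<Longrightarrow> (f k has_sum s k) A"
  shows "((\<lambda>x. \<Sum>k\<in>K. f k x) has_sum (\<Sum>k\<in>K. s k)) A"
  using assms by (induction K rule: finite_induct) (simp_all add: has_sum_add)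

section \<open>Absolute convergence and summation over all columns\<close>

context
  fixes q :: complex
  assumes q_norm: "norm q < 1"
begin

text \<open>Without an order condition the lists form a product set, and the sum splits into the
  one-column series of \<open>summable_norm_gwt\<close>.\<close>

lemma summable_on_gwts: "gwts z q Ls summable_on {ms. length ms = length Ls}"
proof (induction Ls)
  case (Cons L Ls)
  let ?A = "{ms :: nat list. length ms = length Ls}"
  have nonneg: "0 \<le> gwts z q Ks ms" for z q Ks ms
    by (induction z q Ks ms rule: gwts.induct) auto
  have "(\<lambda>(m, ms). gwts z q (L # Ls) (m # ms)) summable_on Sigma UNIV (\<lambda>_. ?A)"
  proof (rule summable_on_SigmaI)
    show "((\<lambda>ms. case (m, ms) of (m, ms) \<Rightarrow> gwts z q (L # Ls) (m # ms)) has_sum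
        norm (gwt z q L m) * infsum (gwts z q Ls) ?A) ?A" for m
      using has_sum_cmult_right[OF has_sum_infsum[OF Cons]] by simp
    show "(\<lambda>m. norm (gwt z q L m) * infsum (gwts z q Ls) ?A) summable_on UNIV"
      using norm_summable_imp_summable_on[of "\<lambda>m. norm (gwt z q L m)"] summable_norm_gwt[OF q_norm]
      by (intro summable_on_cmult_left) simp
  qed (simp add: nonneg)
  moreover have "{ms. length ms = length (L # Ls)} = (\<lambda>(m, ms). m # ms) ` Sigma UNIV (\<lambda>_. ?A)"
    by (auto simp: image_iff length_Suc_conv)
  moreover have "inj_on (\<lambda>(m, ms). m # ms) (Sigma UNIV (\<lambda>_. ?A))"
    by (auto simp: inj_on_def)
  ultimately show ?case
    by (simp add: summable_on_reindex o_def case_prod_unfold del: gwts.simps)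
qed (simp add: finite_subset[of _ "{[]}"])

text \<open>Each column contributes one reciprocal q-Pochhammer symbol, and the end one more with
  the infinite product. Each of these is bounded by a constant depending only on \<open>z\<close>
  and \<open>q\<close>.\<close>

lemma norm_lweight_le:
  obtains C where "\<And>Ls P ms. length ms = length Ls \<Longrightarrow> norm (lweight z q Ls P ms) \<le> C ^ Suc (length Ls) * gwts z q Ls ms"
proof -
  obtain C where C: "C \<ge> 1" "\<And>n. norm (1 / qpoch q q n) \<le> C"
    using inverse_qpoch_self_bounded[OF q_norm] by blast
  define K where "K = C * exp (norm z / (1 - norm q))"
  have e1: "exp (norm z / (1 - norm q)) \<ge> 1" using q_norm by simp
  then have CK: "C \<le> K" unfolding K_def using C(1) mult_left_mono[OF e1, of C] by simp
  have "norm (lweight z q Ls P ms) \<le> K ^ Suc (length Ls) * gwts z q Ls ms" if "length ms = length Ls" for Ls P ms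
    using that
  proof (induction Ls arbitrary: ms P)
    case Nil
    have "norm (z * q ^ Suc P) \<le> norm z"
      using q_norm unfolding norm_mult norm_power by (intro mult_left_le power_le_one) auto
    then have "norm (z * q ^ Suc P) / (1 - norm q) \<le> norm z / (1 - norm q)"
      using q_norm by (intro divide_right_mono) auto
    then have "norm (qpoch_inf (z * q ^ Suc P) q) \<le> exp (norm z / (1 - norm q))"
      by (intro order_trans[OF norm_qpoch_inf_le[OF q_norm]]) simp
    then have "norm (1 / qpoch q q P) * norm (qpoch_inf (z * q ^ Suc P) q) \<le> K"
      unfolding K_def using C by (intro mult_mono) auto
    then show ?case by (simp add: norm_divide)
  next
    case (Cons L Ls)
    then obtain m ns where ms: "ms = m # ns" "length ns = length Ls" by (cases ms) auto
    have "norm (lweight z q (L # Ls) P ms) = norm (gwt z q L m) * (norm (1 / qpoch q q (P - m)) * norm (lweight z q Ls m ns))"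
      unfolding ms by (simp add: norm_mult norm_divide)
    also have "\<dots> \<le> norm (gwt z q L m) * (K * (K ^ Suc (length Ls) * gwts z q Ls ns))"
      using C CK Cons.IH[OF ms(2), of m] by (intro mult_left_mono mult_mono) (auto intro: order_trans)
    finally show ?case unfolding ms by (simp add: mult_ac)
  qed
  then show ?thesis using that by blast
qed

context
  assumes q_nz: "q \<noteq> 0"
begin

text \<open>By induction the columns after \<open>m\<close> are summed first, which gives a sum over
  the next column \<open>k\<close> of \<nu>. After exchanging \<open>m\<close> and \<open>k\<close>,
  \<open>durfee_finite_shift\<close> replaces \<open>m\<close> by a column \<open>n\<close> of
  \<nu>.\<close>

lemma sum_lweight:
  assumes "sorted_wrt (\<ge>) Ls"
  shows "(\<Sum>ms\<in>dec_lists (length Ls) P. lweight z q Ls P ms)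
    = qpoch_inf (z * q ^ Suc P) q * (\<Sum>n\<le>P. rsum z q Ls n / qpoch q q (P - n))"
  using assms
proof (induction Ls arbitrary: P)
  case Nil
  have "(\<Sum>n\<le>P. rsum z q [] n / qpoch q q (P - n)) = (\<Sum>n\<in>{0}. rsum z q [] n / qpoch q q (P - n))"
    by (rule sum.mono_neutral_right) auto
  then show ?case by simp
next
  case (Cons L Ls)
  let ?D = "\<lambda>m k. gwt z q L m / (qpoch q q (m - k) * qpoch q q (P - m)) * qpoch_inf (z * q ^ Suc m) q"
  let ?E = "\<lambda>n k. gwt z q L n * gbin (L - k) (n - k) q / qpoch q q (P - n)"
  have swap: "(\<Sum>m\<le>P. \<Sum>k\<le>m. g m k) = (\<Sum>k\<le>P. \<Sum>m=k..P. g m k)" for g :: "nat \<Rightarrow> nat \<Rightarrow> complex"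
    by (simp add: sum.Sigma) (rule sum.reindex_bij_witness[where i = prod.swap and j = prod.swap], auto)
  have inner: "rsum z q Ls k * (\<Sum>m=k..P. ?D m k)
      = rsum z q Ls k * (qpoch_inf (z * q ^ Suc P) q * (\<Sum>n=k..P. ?E n k))" if "k \<le> P" for k
  proof (cases "k \<le> L")
    case True
    then show ?thesis using durfee_finite_shift[OF q_norm q_nz True that] by simp
  next
    \<comment> \<open>Beyond the range \<open>k \<le> L\<close> of
      \<open>durfee_finite_shift\<close>, both sides are zero by \<open>rsum_eq_0\<close>.\<close>
    case False
    then have "hd0 Ls < k" using Cons.prems by (cases Ls) auto
    then show ?thesis using Cons.prems by (simp add: rsum_eq_0)
  qed
  have "(\<Sum>ms\<in>dec_lists (length (L # Ls)) P. lweight z q (L # Ls) P ms)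
      = (\<Sum>m\<le>P. gwt z q L m / qpoch q q (P - m) * (\<Sum>ms\<in>dec_lists (length Ls) m. lweight z q Ls m ms))"
    by (simp add: sum_dec_lists_Suc sum_distrib_left)
  also have "\<dots> = (\<Sum>m\<le>P. \<Sum>k\<le>m. rsum z q Ls k * ?D m k)"
    using Cons by (simp add: sum_distrib_left mult_ac)
  also have "\<dots> = (\<Sum>k\<le>P. rsum z q Ls k * (\<Sum>m=k..P. ?D m k))"
    by (simp only: swap sum_distrib_left)
  also have "\<dots> = (\<Sum>k\<le>P. rsum z q Ls k * (qpoch_inf (z * q ^ Suc P) q * (\<Sum>n=k..P. ?E n k)))"
    by (rule sum.cong[OF refl], rule inner) simp
  also have "\<dots> = qpoch_inf (z * q ^ Suc P) q * (\<Sum>k\<le>P. \<Sum>n=k..P. rsum z q Ls k * ?E n k)"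
    unfolding sum_distrib_left by (simp only: mult_ac)
  also have "\<dots> = qpoch_inf (z * q ^ Suc P) q * (\<Sum>n\<le>P. \<Sum>k\<le>n. rsum z q Ls k * ?E n k)"
    by (simp only: swap)
  also have "\<dots> = qpoch_inf (z * q ^ Suc P) q * (\<Sum>n\<le>P. rsum z q (L # Ls) n / qpoch q q (P - n))"
    by (simp add: sum_distrib_left sum_divide_distrib mult_ac)
  finally show ?case .
qed

text \<open>The analogous step for the first column, which has no bound \<open>P\<close> and so
  needs \<open>durfee_infinite_shift\<close>.\<close>

lemma has_sum_rsum:
  assumes "sorted_wrt (\<ge>) (L # Ls)"
  shows "((\<lambda>m. gwt z q L m * (qpoch_inf (z * q ^ Suc m) q * (\<Sum>k\<le>m. rsum z q Ls k / qpoch q q (m - k))))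
     has_sum (\<Sum>n\<le>L. rsum z q (L # Ls) n)) UNIV"
proof -
  let ?D = "\<lambda>k m. gwt z q L m / qpoch q q (m - k) * qpoch_inf (z * q ^ Suc m) q"
  have van: "rsum z q Ls k = 0" if "L < k" for k
    using assms that by (intro rsum_eq_0) (cases Ls; auto)+
  have 1: "((\<lambda>m. if k \<le> m then rsum z q Ls k * ?D k m else 0) has_sum
      rsum z q Ls k * (\<Sum>n=k..L. gwt z q L n * gbin (L - k) (n - k) q)) UNIV" if "k \<le> L" for k
  proof -
    have "((\<lambda>m. rsum z q Ls k * ?D k m) has_sum
      rsum z q Ls k * (\<Sum>n=k..L. gwt z q L n * gbin (L - k) (n - k) q)) {k..}"
      by (intro has_sum_cmult_right durfee_infinite_shift[OF q_norm q_nz that])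
    then show ?thesis by (rule has_sum_cong_neutral[THEN iffD1, rotated -1]) auto
  qed
  \<comment> \<open>A range for \<open>k\<close> that does not depend on \<open>m\<close> allows the
    series over \<open>m\<close> to be added. Afterwards \<open>van\<close> restores the range
    \<open>k \<le> m\<close>.\<close>
  have "((\<lambda>m. \<Sum>k\<le>L. if k \<le> m then rsum z q Ls k * ?D k m else 0) has_sum
      (\<Sum>k\<le>L. rsum z q Ls k * (\<Sum>n=k..L. gwt z q L n * gbin (L - k) (n - k) q))) UNIV"
    using 1 by (intro has_sum_finite_sum) auto
  moreover have "(\<Sum>k\<le>L. if k \<le> m then rsum z q Ls k * ?D k m else 0)
      = gwt z q L m * (qpoch_inf (z * q ^ Suc m) q * (\<Sum>k\<le>m. rsum z q Ls k / qpoch q q (m - k)))" for m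
  proof -
    have "(\<Sum>k\<le>L. if k \<le> m then rsum z q Ls k * ?D k m else 0) = (\<Sum>k\<in>{..L} \<inter> {..m}. rsum z q Ls k * ?D k m)"
      by (subst sum.inter_restrict) simp_all
    also have "\<dots> = (\<Sum>k\<le>m. rsum z q Ls k * ?D k m)"
      using van by (intro sum.mono_neutral_left) auto
    finally show ?thesis by (simp add: sum_distrib_left mult_ac)
  qed
  moreover have "(\<Sum>k\<le>L. rsum z q Ls k * (\<Sum>n=k..L. gwt z q L n * gbin (L - k) (n - k) q)) = (\<Sum>n\<le>L. rsum z q (L # Ls) n)"
  proof -
    have "(\<Sum>k\<le>L. \<Sum>n=k..L. rsum z q Ls k * (gwt z q L n * gbin (L - k) (n - k) q))
       = (\<Sum>n\<le>L. \<Sum>k\<le>n. rsum z q Ls k * (gwt z q L n * gbin (L - k) (n - k) q))"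
      by (simp add: sum.Sigma) (rule sum.reindex_bij_witness[where i = prod.swap and j = prod.swap], auto)
    then show ?thesis by (simp add: sum_distrib_left mult_ac)
  qed
  ultimately show ?thesis by simp
qed

text \<open>The first column has no predecessor and hence no divisor, so its weight stands outside
  \<open>lweight\<close>.\<close>

lemma has_sum_lweight:
  assumes "sorted_wrt (\<ge>) (L # Ls)"
  shows "((\<lambda>ms. gwt z q L (hd ms) * lweight z q Ls (hd ms) (tl ms))
     has_sum (\<Sum>ns\<in>dec_lists (length (L # Ls)) L. rweight z q (L # Ls) ns))
     {ms. length ms = length (L # Ls) \<and> sorted_wrt (\<ge>) ms}"
proof -
  let ?f = "\<lambda>ms. gwt z q L (hd ms) * lweight z q Ls (hd ms) (tl ms)"
  let ?A = "{ms :: nat list. length ms = length (L # Ls) \<and> sorted_wrt (\<ge>) ms}"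
  let ?B = "SIGMA m:UNIV. dec_lists (length Ls) m"
  have A: "?A = (\<lambda>(m, ms). m # ms) ` ?B"
    by (auto simp: image_iff length_Suc_conv dec_lists_def)
  have inj: "inj_on (\<lambda>(m, ms). m # ms) ?B"
    by (auto simp: inj_on_def)
  obtain C where C: "\<And>Ls P ms. length ms = length Ls \<Longrightarrow> norm (lweight z q Ls P ms) \<le> C ^ Suc (length Ls) * gwts z q Ls ms"
    using norm_lweight_le by blast
  \<comment> \<open>Absolute convergence allows the iterated sum, over the tail and then over the
    head, to be read as one sum over lists.\<close>
  have "(\<lambda>ms. norm (?f ms)) summable_on ?A"
  proof (rule Infinite_Sum.abs_summable_on_comparison_test')
    have "gwts z q (L # Ls) summable_on ?A"
      by (rule summable_on_subset_banach[OF summable_on_gwts]) auto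
    then show "(\<lambda>ms. C ^ Suc (length Ls) * gwts z q (L # Ls) ms) summable_on ?A"
      by (rule summable_on_cmult_right)
    fix ms assume "ms \<in> ?A"
    then obtain m ns where ms: "ms = m # ns" "length ns = length Ls" by (cases ms) auto
    show "norm (?f ms) \<le> C ^ Suc (length Ls) * gwts z q (L # Ls) ms"
      using mult_left_mono[OF C[OF ms(2), of m] norm_ge_zero[of "gwt z q L m"]]
      by (simp add: ms norm_mult mult_ac)
  qed
  then have "?f summable_on ?A" by (rule abs_summable_summable)
  then have summ: "(\<lambda>(m, ms). ?f (m # ms)) summable_on ?B"
    unfolding A summable_on_reindex[OF inj] by (simp add: o_def case_prod_unfold)
  have "((\<lambda>(m, ms). ?f (m # ms)) has_sum (\<Sum>n\<le>L. rsum z q (L # Ls) n)) ?B"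
  proof (rule has_sum_SigmaI[OF _ has_sum_rsum[OF assms] summ])
    fix m
    have "(\<Sum>ms\<in>dec_lists (length Ls) m. ?f (m # ms)) = gwt z q L m * (qpoch_inf (z * q ^ Suc m) q * (\<Sum>k\<le>m. rsum z q Ls k / qpoch q q (m - k)))"
      using assms sum_lweight[of Ls z m] by (simp add: sum_distrib_left[symmetric])
    then show "((\<lambda>ms. case (m, ms) of (m, ms) \<Rightarrow> ?f (m # ms)) has_sum
       gwt z q L m * (qpoch_inf (z * q ^ Suc m) q * (\<Sum>k\<le>m. rsum z q Ls k / qpoch q q (m - k)))) (dec_lists (length Ls) m)"
      by (simp add: has_sum_finite_iff)
  qed
  moreover have "(\<Sum>n\<le>L. rsum z q (L # Ls) n) = (\<Sum>ns\<in>dec_lists (length (L # Ls)) L. rweight z q (L # Ls) ns)"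
    using sum_rweight[of "\<lambda>_. 1" z q "L # Ls" L] by simp
  ultimately show ?thesis
    unfolding A has_sum_reindex[OF inj] by (simp add: o_def case_prod_unfold)
qed

end

end

subsection \<open>Columns of a partition\<close>

lemma part_antimono:
  assumes "is_partition p" "1 \<le> j" "j \<le> j'"
  shows "part p j' \<le> part p j"
proof (cases "j' = j \<or> length p < j'")
  case False
  then have "p ! (j - 1) \<ge> p ! (j' - 1)"
    using assms unfolding is_partition_def by (intro sorted_wrt_nth_less[of "(\<ge>)"]) auto
  then show ?thesis using False assms by (simp add: part_def)
qed (auto simp: part_def)

lemma part_pos_iff:
  assumes "is_partition p" "1 \<le> j"
  shows "0 < part p j \<longleftrightarrow> j \<le> length p"
  using assms by (auto simp: part_def is_partition_def)

lemma eq_atLeastAtMost_card: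
  assumes "finite (S :: nat set)" "0 \<notin> S" "\<And>i j. j \<in> S \<Longrightarrow> 1 \<le> i \<Longrightarrow> i \<le> j \<Longrightarrow> i \<in> S"
  shows "S = {1..card S}"
proof (cases "S = {}")
  case False
  have "S = {1..Max S}"
  proof (intro equalityI subsetI)
    fix j assume "j \<in> S"
    then show "j \<in> {1..Max S}" using assms(1,2) by (cases j) auto
  next
    fix j assume "j \<in> {1..Max S}"
    then show "j \<in> S" using assms(3)[OF Max_in[OF assms(1) False], of j] by simp
  qed
  then show ?thesis by (metis card_atLeastAtMost diff_Suc_1)
qed simp

lemma conj_part_set:
  assumes "is_partition p" "1 \<le> i"
  shows "{j. 1 \<le> j \<and> i \<le> part p j} = {1..conj_part p i}"
  unfolding conj_part_def
proof (rule eq_atLeastAtMost_card)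
  show "finite {j. 1 \<le> j \<and> i \<le> part p j}"
    by (rule finite_subset[of _ "{..length p}"]) (use assms in \<open>auto simp: part_def split: if_splits\<close>)
  show "j \<in> {j. 1 \<le> j \<and> i \<le> part p j}"
    if "k \<in> {j. 1 \<le> j \<and> i \<le> part p j}" "1 \<le> j" "j \<le> k" for j k
    using that part_antimono[OF assms(1), of j k] by simp
qed simp

text \<open>Both sides say that the diagram of \<open>p\<close> has a box in row \<open>j\<close>
  and column \<open>i\<close>.\<close>

lemma le_conj_part_iff:
  assumes "is_partition p" "1 \<le> i" "1 \<le> j"
  shows "j \<le> conj_part p i \<longleftrightarrow> i \<le> part p j"
  using conj_part_set[OF assms(1,2)] assms(3) by (auto simp: set_eq_iff)

lemma conj_part_antimono:
  assumes "is_partition p" "1 \<le> i" "i \<le> i'"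
  shows "conj_part p i' \<le> conj_part p i"
proof (cases "conj_part p i' = 0")
  case False
  then show ?thesis
    using assms le_conj_part_iff[of p i' "conj_part p i'"] le_conj_part_iff[of p i "conj_part p i'"] by simp
qed simp

lemma conj_part_eq_0:
  assumes "is_partition p" "1 \<le> i" "part p 1 < i"
  shows "conj_part p i = 0"
  using le_conj_part_iff[OF assms(1,2), of 1] assms(3) by simp

lemma contained_iff_conj_part_le:
  assumes "is_partition nu" "is_partition la"
  shows "contained nu la \<longleftrightarrow> (\<forall>i\<ge>1. conj_part nu i \<le> conj_part la i)"
proof
  assume c: "contained nu la"
  show "\<forall>i\<ge>1. conj_part nu i \<le> conj_part la i"
  proof (intro allI impI)
    fix i :: nat assume i: "1 \<le> i"
    show "conj_part nu i \<le> conj_part la i"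
    proof (cases "conj_part nu i = 0")
      case False
      then have "i \<le> part nu (conj_part nu i)" using le_conj_part_iff[OF assms(1) i, of "conj_part nu i"] by simp
      also have "\<dots> \<le> part la (conj_part nu i)" using c False by (simp add: contained_def)
      finally show ?thesis using le_conj_part_iff[OF assms(2) i] False by simp
    qed simp
  qed
next
  assume c: "\<forall>i\<ge>1. conj_part nu i \<le> conj_part la i"
  show "contained nu la"
    unfolding contained_def
  proof (intro allI impI)
    fix j :: nat assume j: "1 \<le> j"
    show "part nu j \<le> part la j"
    proof (cases "part nu j = 0")
      case False
      then have "j \<le> conj_part nu (part nu j)" using le_conj_part_iff[OF assms(1) _ j] by simp
      also have "\<dots> \<le> conj_part la (part nu j)" using c False by simp
      finally show ?thesis using le_conj_part_iff[OF assms(2) _ j] False by simp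
    qed simp
  qed
qed

lemma partition_eqI:
  assumes "is_partition p" "is_partition r" "\<And>j. 1 \<le> j \<Longrightarrow> part p j = part r j"
  shows "p = r"
proof (rule nth_equalityI)
  have *: "j \<le> length p \<longleftrightarrow> j \<le> length r" if "1 \<le> j" for j
    using part_pos_iff[OF assms(1) that] part_pos_iff[OF assms(2) that] assms(3)[OF that] by simp
  have "length p \<le> length r" using *[of "length p"] by (cases "length p = 0") simp_all
  moreover have "length r \<le> length p" using *[of "length r"] by (cases "length r = 0") simp_all
  ultimately show len: "length p = length r" by simp
  show "p ! k = r ! k" if "k < length p" for k
    using assms(3)[of "Suc k"] that len by (simp add: part_def)
qed

section \<open>Partitions with parts at most \<open>l\<close> as decreasing lists of
  \<open>l\<close> columns\<close>

definition columns :: "nat \<Rightarrow> nat list \<Rightarrow> nat list" where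
  "columns l p = map (conj_part p) [1..<Suc l]"

lemma length_columns [simp]: "length (columns l p) = l"
  by (simp add: columns_def)

lemma nth_columns: "i < l \<Longrightarrow> columns l p ! i = conj_part p (Suc i)"
  unfolding columns_def by (subst nth_map) (simp_all del: upt_Suc)

lemma sorted_columns: "is_partition p \<Longrightarrow> sorted_wrt (\<ge>) (columns l p)"
  by (simp add: sorted_wrt_iff_nth_less nth_columns conj_part_antimono)

lemma inj_on_columns: "inj_on (columns l) {p. is_partition p \<and> part p 1 \<le> l}"
proof (rule inj_onI, clarify)
  fix p r assume p: "is_partition p" "part p 1 \<le> l" and r: "is_partition r" "part r 1 \<le> l"
    and eq: "columns l p = columns l r"
  have c: "conj_part p i = conj_part r i" if "1 \<le> i" for i
  proof (cases "i \<le> l")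
    case True
    then show ?thesis using eq nth_columns[of "i - 1" l] that by (metis Suc_diff_1 Suc_le_eq One_nat_def)
  next
    case False
    then show ?thesis using p r that by (simp add: conj_part_eq_0)
  qed
  \<comment> \<open>Equal columns give containment both ways, hence equal parts.\<close>
  show "p = r"
    by (rule partition_eqI[OF p(1) r(1)])
      (metis contained_def contained_iff_conj_part_le[OF p(1) r(1)] contained_iff_conj_part_le[OF r(1) p(1)] c order_antisym order_refl)
qed

lemma columns_surj:
  fixes ms :: "nat list"
  assumes "length ms = l" "sorted_wrt (\<ge>) ms"
  obtains p where "is_partition p" "part p 1 \<le> l" "columns l p = ms"
proof -
  \<comment> \<open>\<open>h\<close> is the conjugate of \<open>ms\<close>. It is positive exactly
    up to the largest entry of \<open>ms\<close>, where the list \<open>p\<close> of parts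
    ends.\<close>
  define h where "h j = card {i. 1 \<le> i \<and> i \<le> l \<and> j \<le> ms ! (i - 1)}" for j
  define p where "p = map h [1..<Suc (hd0 ms)]"
  have anti: "ms ! i' \<le> ms ! i" if "i \<le> i'" "i' < l" for i i'
    using assms that sorted_wrt_nth_less[of "(\<ge>)" ms i i'] by (cases "i = i'") auto
  have h_set: "{i. 1 \<le> i \<and> i \<le> l \<and> j \<le> ms ! (i - 1)} = {1..h j}" for j
    unfolding h_def
  proof (rule eq_atLeastAtMost_card)
    show "i \<in> {i. 1 \<le> i \<and> i \<le> l \<and> j \<le> ms ! (i - 1)}"
      if "k \<in> {i. 1 \<le> i \<and> i \<le> l \<and> j \<le> ms ! (i - 1)}" "1 \<le> i" "i \<le> k" for i k
    proof -
      have "i - 1 \<le> k - 1" "k - 1 < l" using that by auto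
      from anti[OF this] show ?thesis using that by auto
    qed
  qed (auto intro: finite_subset[of _ "{..l}"])
  have le_h: "i \<le> h j \<longleftrightarrow> i \<le> l \<and> j \<le> ms ! (i - 1)" if "1 \<le> i" for i j
    using h_set[of j] that by (auto simp: set_eq_iff)
  have h_0: "h j = 0" if "hd0 ms < j" for j
    using le_h[of 1 j] that assms(1) by (cases ms) auto
  have part_p: "part p j = h j" if "1 \<le> j" for j
    using that h_0[of j] by (auto simp: p_def part_def simp del: upt_Suc)
  have h_anti: "h j' \<le> h j" if "j \<le> j'" for j j'
    using that le_h[of "h j'" j'] le_h[of "h j'" j] by (cases "h j' = 0") auto
  have h_pos: "0 < h j" if "j \<le> hd0 ms" "1 \<le> j" for j
    using that le_h[of 1 j] assms(1) by (cases ms) auto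
  have "is_partition p"
    unfolding is_partition_def
    by (auto simp: sorted_wrt_iff_nth_less p_def h_anti h_pos simp del: upt_Suc)
  moreover have "part p 1 \<le> l"
    using le_h[of "h 1" 1] by (cases "h 1 = 0") (auto simp: part_p)
  moreover have "columns l p = ms"
  proof (rule nth_equalityI)
    fix i assume "i < length (columns l p)"
    then have i: "i < l" by simp
    have "{j. 1 \<le> j \<and> Suc i \<le> part p j} = {1..ms ! i}"
      using i by (auto simp: part_p le_h)
    then show "columns l p ! i = ms ! i" using i by (simp add: nth_columns conj_part_def)
  qed (simp add: assms)
  ultimately show ?thesis using that by blast
qed

lemma bij_betw_columns:
  "bij_betw (columns l) {p. is_partition p \<and> part p 1 \<le> l} {ms :: nat list. length ms = l \<and> sorted_wrt (\<ge>) ms}"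
  unfolding bij_betw_def
proof (intro conjI inj_on_columns equalityI subsetI)
  fix ms assume "ms \<in> {ms :: nat list. length ms = l \<and> sorted_wrt (\<ge>) ms}"
  then obtain p where "is_partition p" "part p 1 \<le> l" "columns l p = ms"
    using columns_surj by blast
  then show "ms \<in> columns l ` {p. is_partition p \<and> part p 1 \<le> l}" by blast
qed (auto simp: sorted_columns)

lemma contained_iff_columns:
  assumes "is_partition nu" "is_partition la" "part la 1 \<le> l"
  shows "contained nu la \<longleftrightarrow> part nu 1 \<le> l \<and> list_all2 (\<le>) (columns l nu) (columns l la)"
proof
  assume c: "contained nu la"
  then have "part nu 1 \<le> l" using assms(3) unfolding contained_def by (metis le_trans order_refl)
  then show "part nu 1 \<le> l \<and> list_all2 (\<le>) (columns l nu) (columns l la)"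
    using c contained_iff_conj_part_le[OF assms(1,2)] by (simp add: list_all2_conv_all_nth nth_columns)
next
  assume c: "part nu 1 \<le> l \<and> list_all2 (\<le>) (columns l nu) (columns l la)"
  have "conj_part nu i \<le> conj_part la i" if "1 \<le> i" for i
  proof (cases "i \<le> l")
    case True
    then have "columns l nu ! (i - 1) \<le> columns l la ! (i - 1)"
      using c that by (simp add: list_all2_conv_all_nth)
    then show ?thesis using True that by (simp add: nth_columns)
  next
    case False
    then show ?thesis using c that assms by (simp add: conj_part_eq_0)
  qed
  then show "contained nu la" using contained_iff_conj_part_le[OF assms(1,2)] by blast
qed

section \<open>Partition statistics and both summands in terms of columns\<close>

lemma sum_weighted_parts:
  assumes "is_partition p" "part p 1 \<le> l"
  shows "(\<Sum>j=1..length p. w j * part p j) = (\<Sum>i=1..l. \<Sum>j=1..conj_part p i. (w j :: nat))"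
proof -
  \<comment> \<open>The boxes of the diagram, with weight \<open>w j\<close> in row
    \<open>j\<close>, are counted by rows and by columns.\<close>
  have "w j * part p j = (\<Sum>i=1..l. if i \<le> part p j then w j else 0)" if "j \<in> {1..length p}" for j
  proof -
    have "{1..l} \<inter> {i. i \<le> part p j} = {1..part p j}"
      using that part_antimono[OF assms(1), of 1 j] assms(2) by auto
    then show ?thesis by (simp add: sum.If_cases)
  qed
  then have "(\<Sum>j=1..length p. w j * part p j) = (\<Sum>j=1..length p. \<Sum>i=1..l. if i \<le> part p j then w j else 0)"
    by simp
  also have "\<dots> = (\<Sum>i=1..l. \<Sum>j=1..length p. if i \<le> part p j then w j else 0)"
    by (rule sum.swap)
  also have "\<dots> = (\<Sum>i=1..l. \<Sum>j=1..conj_part p i. w j)"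
  proof (rule sum.cong[OF refl])
    fix i assume "i \<in> {1..l}"
    then have i: "1 \<le> i" by simp
    have "{1..length p} \<inter> {j. i \<le> part p j} = {j. 1 \<le> j \<and> i \<le> part p j}"
      using i by (auto simp: part_def split: if_splits)
    then show "(\<Sum>j=1..length p. if i \<le> part p j then w j else 0) = (\<Sum>j=1..conj_part p i. w j)"
      unfolding conj_part_set[OF assms(1) i] by (simp add: sum.If_cases)
  qed
  finally show ?thesis .
qed

lemma psize_eq:
  assumes "is_partition p" "part p 1 \<le> l"
  shows "psize p = (\<Sum>i=1..l. conj_part p i)"
  using sum_weighted_parts[OF assms, of "\<lambda>_. 1"] by (simp add: psize_def)

lemma n_part_eq:
  assumes "is_partition p" "part p 1 \<le> l"
  shows "2 * n_part p + psize p = (\<Sum>i=1..l. (conj_part p i)\<^sup>2)"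
proof -
  \<comment> \<open>The row weights are the odd numbers, and the first \<open>c\<close> of them add
    up to \<open>c\<^sup>2\<close>.\<close>
  have sq: "(\<Sum>j=1..c. 2 * (j - 1) + 1) = c\<^sup>2" for c :: nat
    by (induction c) (simp_all add: power2_eq_square)
  have "2 * n_part p + psize p = (\<Sum>j=1..length p. (2 * (j - 1) + 1) * part p j)"
    unfolding n_part_def psize_def sum_distrib_left sum.distrib[symmetric]
    by (simp only: distrib_right mult_1 mult.assoc)
  then show ?thesis unfolding sum_weighted_parts[OF assms] sq .
qed

lemma conj_inner_eq:
  assumes "is_partition la" "part la 1 \<le> l"
  shows "conj_inner la mu = (\<Sum>i=1..l. conj_part la i * conj_part mu i)"
  unfolding conj_inner_def
  by (rule sum.mono_neutral_left) (use assms in \<open>auto simp: conj_part_eq_0\<close>)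

lemma b_part_eq:
  assumes "is_partition mu" "part mu 1 \<le> l"
  shows "b_part mu q = (\<Prod>i=1..l. qpoch q q (conj_part mu i - conj_part mu (i + 1)))"
  unfolding b_part_def
  by (rule prod.mono_neutral_left) (use assms in \<open>auto simp: conj_part_eq_0\<close>)

text \<open>\<open>m a\<close> plays the preceding column, so \<open>a = 1\<close> covers all
  columns after the first. The induction runs downwards from \<open>b\<close>.\<close>

lemma lweight_map:
  assumes "a \<le> b"
  shows "lweight z q (map L [Suc a..<Suc b]) (m a) (map m [Suc a..<Suc b])
    = (\<Prod>i=Suc a..b. gwt z q (L i) (m i)) / (\<Prod>i=a..<b. qpoch q q (m i - m (Suc i)))
      * (qpoch_inf (z * q ^ Suc (m b)) q / qpoch q q (m b))"
  using assms
proof (induction a rule: inc_induct)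
  case (step a)
  then have 1: "[Suc a..<Suc b] = Suc a # [Suc (Suc a)..<Suc b]" by (simp add: upt_conv_Cons del: upt_Suc)
  have 2: "{Suc a..b} = insert (Suc a) {Suc (Suc a)..b}" "{a..<b} = insert a {Suc a..<b}"
    using step by auto
  show ?case unfolding 1 2 using step.IH by (simp add: mult.assoc del: upt_Suc)
qed simp

lemma rweight_map:
  assumes "a \<le> b" "m (Suc b) = 0"
  shows "rweight z q (map L [Suc a..<Suc b]) (map m [Suc a..<Suc b])
    = (\<Prod>i=Suc a..b. gwt z q (L i) (m i) * gbin (L i - m (Suc i)) (m i - m (Suc i)) q)"
  using assms(1)
proof (induction a rule: inc_induct)
  case (step a)
  then have 1: "[Suc a..<Suc b] = Suc a # [Suc (Suc a)..<Suc b]" by (simp add: upt_conv_Cons del: upt_Suc)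
  have 2: "{Suc a..b} = insert (Suc a) {Suc (Suc a)..b}"
    using step by auto
  have 3: "hd0 (map m [Suc (Suc a)..<Suc b]) = m (Suc (Suc a))"
  proof (cases "Suc a = b")
    case False
    then have "[Suc (Suc a)..<Suc b] = Suc (Suc a) # [Suc (Suc (Suc a))..<Suc b]"
      using step by (simp add: upt_conv_Cons del: upt_Suc)
    then show ?thesis by (simp del: upt_Suc)
  qed (use assms(2) in simp)
  show ?case unfolding 1 2 using step.IH 3 by (simp del: upt_Suc)
qed simp

lemma C_coeff_eq_rweight:
  assumes q_nz: "q \<noteq> 0"
    and la: "is_partition la" "part la 1 \<le> l" and nu: "is_partition nu" "contained nu la"
  shows "C_coeff la nu (1 / q) * z ^ psize nu = rweight z q (columns l la) (columns l nu)"
proof -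
  have le: "conj_part nu i \<le> conj_part la i" if "1 \<le> i" for i
    using nu contained_iff_conj_part_le[OF nu(1) la(1)] that by blast
  have nul: "part nu 1 \<le> l" using contained_iff_columns[OF nu(1) la] nu(2) by blast
  \<comment> \<open>Between \<open>part la 1\<close> and \<open>l\<close> all columns are zero, so
    the sum and product in \<open>C_coeff\<close> extend to \<open>l\<close>, and
    \<open>C_coeff_factor\<close> applies column by column.\<close>
  have la0: "conj_part la i = 0" if "i \<in> {1..l} - {1..part la 1}" for i
    using that la by (auto intro: conj_part_eq_0)
  have nu0: "conj_part nu i = 0" if "i \<in> {1..l} - {1..part la 1}" for i
    using that la0[OF that] le[of i] by auto
  have nu1: "conj_part nu (i + 1) = 0" if "i \<in> {1..l} - {1..part la 1}" for i
    using that nu0[OF that] conj_part_antimono[OF nu(1), of i "i + 1"] by auto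
  have "(\<Sum>i=1..part la 1. conj_part nu (i + 1) * (conj_part la i - conj_part nu i))
      = (\<Sum>i=1..l. conj_part nu (i + 1) * (conj_part la i - conj_part nu i))"
    by (rule sum.mono_neutral_left) (use la nu1 in auto)
  moreover have "(\<Prod>i=1..part la 1. qbinomial (conj_part la i - conj_part nu (i + 1)) (conj_part la i - conj_part nu i) (1 / q))
      = (\<Prod>i=1..l. qbinomial (conj_part la i - conj_part nu (i + 1)) (conj_part la i - conj_part nu i) (1 / q))"
    by (rule prod.mono_neutral_left) (use la la0 nu0 nu1 in \<open>auto simp: qbinomial_def\<close>)
  ultimately have "C_coeff la nu (1 / q) * z ^ psize nu = (\<Prod>i=1..l.
      (1 / q) ^ (conj_part nu (i + 1) * (conj_part la i - conj_part nu i)) *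
      qbinomial (conj_part la i - conj_part nu (i + 1)) (conj_part la i - conj_part nu i) (1 / q) * z ^ conj_part nu i)"
    unfolding C_coeff_def psize_eq[OF nu(1) nul] by (simp only: prod.distrib power_sum)
  also have "\<dots> = (\<Prod>i=1..l. gwt z q (conj_part la i) (conj_part nu i) *
      gbin (conj_part la i - conj_part nu (i + 1)) (conj_part nu i - conj_part nu (i + 1)) q)"
    by (intro prod.cong[OF refl] C_coeff_factor[OF q_nz]) (use le conj_part_antimono[OF nu(1)] in auto)
  also have "\<dots> = rweight z q (columns l la) (columns l nu)"
    unfolding columns_def
    using rweight_map[of 0 l "conj_part nu" z q "conj_part la"] conj_part_eq_0[OF nu(1), of "Suc l"] nul
    by (simp del: upt_Suc)
  finally show ?thesis .
qed

lemma summand_eq_lweight: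
  assumes q_nz: "q \<noteq> 0"
    and la: "is_partition la" "part la 1 \<le> l" and mu: "is_partition mu" "part mu 1 \<le> l" and l: "1 \<le> l"
  shows "z ^ psize mu * q powi (2 * int (n_part mu) + int (psize mu) - int (conj_inner la mu))
      / b_part mu q * qpoch_inf (z * (qpow_conj q mu l * q)) q
    = gwt z q (hd (columns l la)) (hd (columns l mu)) *
      lweight z q (tl (columns l la)) (hd (columns l mu)) (tl (columns l mu))"
proof -
  let ?m = "conj_part mu" and ?L = "conj_part la"
  have upt: "[1..<Suc l] = 1 # [Suc 1..<Suc l]" using l by (simp add: upt_conv_Cons del: upt_Suc)
  \<comment> \<open>Hence the last factor of \<open>b_part\<close> is
    \<open>qpoch q q (?m l)\<close>, the divisor that ends \<open>lweight\<close>.\<close>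
  have ml: "?m (Suc l) = 0" using conj_part_eq_0[OF mu(1), of "Suc l"] mu(2) by simp
  have "2 * int (n_part mu) + int (psize mu) = int (\<Sum>i=1..l. (?m i)\<^sup>2)"
    unfolding n_part_eq[OF mu, symmetric] by simp
  moreover have "q powi (int a - int b) = q ^ a / q ^ b" for a b
    using q_nz by (simp add: power_int_diff)
  ultimately have "z ^ psize mu * q powi (2 * int (n_part mu) + int (psize mu) - int (conj_inner la mu))
      = (\<Prod>i=1..l. gwt z q (?L i) (?m i))"
    unfolding prod_gwt psize_eq[OF mu] conj_inner_eq[OF la] by (simp only: times_divide_eq_right)
  also have "\<dots> = gwt z q (?L 1) (?m 1) * (\<Prod>i=Suc 1..l. gwt z q (?L i) (?m i))"
    using l by (rule prod.atLeast_Suc_atMost)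
  finally have 1: "z ^ psize mu * q powi (2 * int (n_part mu) + int (psize mu) - int (conj_inner la mu)) = \<dots>" .
  have "{1..l} = insert l {1..<l}" using l by auto
  then have 2: "b_part mu q = (\<Prod>i=1..<l. qpoch q q (?m i - ?m (Suc i))) * qpoch q q (?m l)"
    unfolding b_part_eq[OF mu] using ml by (simp add: mult.commute)
  have 3: "qpow_conj q mu l * q = q ^ Suc (?m l)"
    using l by (simp add: qpow_conj_def)
  show ?thesis
    unfolding 1 2 3 columns_def upt list.map list.sel lweight_map[OF l] by simp
qed

theorem theorem18:
  fixes l :: nat and la :: "nat list" and q z :: complex
  assumes "is_partition la" and "part la 1 \<le> l"
    and "norm q < 1" and "q \<noteq> 0"
  shows "((\<lambda>mu. z ^ psize mu
              * q powi (2 * int (n_part mu) + int (psize mu) - int (conj_inner la mu))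
              / b_part mu q
              * qpoch_inf (z * (qpow_conj q mu l * q)) q)
          has_sum (\<Sum>nu | is_partition nu \<and> contained nu la. C_coeff la nu (1 / q) * z ^ psize nu))
         {mu. is_partition mu \<and> part mu 1 \<le> l}"
proof (cases l)
  \<comment> \<open>Only empty partitions remain and \<open>qpow_conj\<close> is 0, so the infinite
    product and both sides are 1.\<close>
  case 0
  have empty: "p = []" if "is_partition p" "part p 1 = 0" for p
    using part_pos_iff[OF that(1), of 1] that(2) by (cases p) auto
  have "{mu. is_partition mu \<and> part mu 1 \<le> l} = {[]}"
    using 0 empty by (auto simp: is_partition_def part_def)
  moreover have "la = []" using assms(1,2) 0 empty by simp
  moreover have "{nu. is_partition nu \<and> contained nu []} = {[]}"
    using empty by (fastforce simp: contained_def is_partition_def part_def)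
  ultimately show ?thesis
    using 0 by (simp add: has_sum_finite_iff psize_def n_part_def conj_inner_def b_part_def
      qpow_conj_def C_coeff_def part_def qpoch_inf_def)
next
  case (Suc n)
  then have l: "1 \<le> l" by simp
  obtain L Ls where Ls: "columns l la = L # Ls" using Suc by (cases "columns l la") (auto dest: arg_cong[of _ _ length])
  have len: "length (L # Ls) = l" unfolding Ls[symmetric] by simp
  have sorted: "sorted_wrt (\<ge>) (L # Ls)" using sorted_columns[OF assms(1), of l] Ls by simp
  let ?g = "\<lambda>ms. gwt z q L (hd ms) * lweight z q Ls (hd ms) (tl ms)"
  \<comment> \<open>Lists not below the columns of \<lambda> contribute zero by
    \<open>rweight_eq_0\<close>; the others are the columns of the \<nu> contained in
    \<lambda>.\<close>
  have "(\<Sum>ns\<in>dec_lists l L. rweight z q (L # Ls) ns)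
      = (\<Sum>ns | length ns = l \<and> sorted_wrt (\<ge>) ns \<and> list_all2 (\<le>) ns (L # Ls). rweight z q (L # Ls) ns)"
  proof (rule sum.mono_neutral_right)
    show "{ns. length ns = l \<and> sorted_wrt (\<ge>) ns \<and> list_all2 (\<le>) ns (L # Ls)} \<subseteq> dec_lists l L"
      by (auto simp: dec_lists_def list_all2_Cons2) (metis order_trans)
    show "\<forall>ns\<in>dec_lists l L - {ns. length ns = l \<and> sorted_wrt (\<ge>) ns \<and> list_all2 (\<le>) ns (L # Ls)}.
        rweight z q (L # Ls) ns = 0"
      using rweight_eq_0[OF sorted] len by (simp add: dec_lists_def)
  qed simp
  also have "{ns. length ns = l \<and> sorted_wrt (\<ge>) ns \<and> list_all2 (\<le>) ns (L # Ls)} =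
      columns l ` {nu. is_partition nu \<and> contained nu la}"
  proof -
    have "{ns. length ns = l \<and> sorted_wrt (\<ge>) ns \<and> list_all2 (\<le>) ns (L # Ls)} =
        {ns \<in> columns l ` {p. is_partition p \<and> part p 1 \<le> l}. list_all2 (\<le>) ns (L # Ls)}"
      unfolding bij_betw_imp_surj_on[OF bij_betw_columns] by simp
    also have "\<dots> = columns l ` {nu. is_partition nu \<and> part nu 1 \<le> l \<and> list_all2 (\<le>) (columns l nu) (columns l la)}"
      unfolding Ls by blast
    also have "{nu. is_partition nu \<and> part nu 1 \<le> l \<and> list_all2 (\<le>) (columns l nu) (columns l la)} =
        {nu. is_partition nu \<and> contained nu la}"
      using contained_iff_columns[OF _ assms(1,2)] by blast
    finally show ?thesis .
  qed
  also have "(\<Sum>ns\<in>columns l ` {nu. is_partition nu \<and> contained nu la}. rweight z q (L # Ls) ns)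
      = (\<Sum>nu | is_partition nu \<and> contained nu la. rweight z q (L # Ls) (columns l nu))"
    using contained_iff_columns[OF _ assms(1,2)]
    by (subst sum.reindex) (auto intro: inj_on_subset[OF inj_on_columns])
  also have "\<dots> = (\<Sum>nu | is_partition nu \<and> contained nu la. C_coeff la nu (1 / q) * z ^ psize nu)"
    using C_coeff_eq_rweight[OF assms(4,1,2)] Ls by (intro sum.cong) auto
  finally have "(?g has_sum (\<Sum>nu | is_partition nu \<and> contained nu la. C_coeff la nu (1 / q) * z ^ psize nu))
      {ms. length ms = l \<and> sorted_wrt (\<ge>) ms}"
    using has_sum_lweight[OF assms(3,4) sorted, of z] unfolding len by simp
  then have "((\<lambda>mu. ?g (columns l mu)) has_sum
      (\<Sum>nu | is_partition nu \<and> contained nu la. C_coeff la nu (1 / q) * z ^ psize nu))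
      {mu. is_partition mu \<and> part mu 1 \<le> l}"
    by (subst has_sum_reindex_bij_betw[OF bij_betw_columns])
  then show ?thesis
    by (rule has_sum_cong[THEN iffD1, rotated])
      (use summand_eq_lweight[OF assms(4,1,2) _ _ l, of _ z] Ls in simp)
qed

end
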